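(* Let $m,n\geq 1$ be integers, $k=\min(m,n)$, $\lambda>0$, and let $\phi(\cdot\,;a)\colon\mathbb{R}\to\mathbb{R}$ be a non-convex penalty function with parameter $a$ satisfying Assumption 1 (stated in the context). Let $Y\in\mathbb{R}^{m\times n}$ and let $Y=U\Sigma V^T$ be the singular value decomposition of $Y$. If $0\leq a<1/\lambda$, then the global minimizer over $X\in\mathbb{R}^{m\times n}$ of $$\Psi(X)=\frac{1}{2}\|Y-X\|_F^2+\lambda\sum_{i=1}^{k}\phi(\sigma_i(X);a)$$ is $$\bar{X}=U\cdot\Theta(\Sigma;\lambda,a)\cdot V^T,$$ where $\Theta$ is the proximal operator (threshold function) associated with $\phi$, applied entrywise to $\Sigma$.
   Context: $\sigma_i(X)$ denotes the $i$-th singular value of $X$ (the $k=\min(m,n)$ singular values are nonnegative, listed in nonincreasing order with multiplicity), and $\|\cdot\|_F$ is the Frobenius norm. In the singular value decomposition $Y=U\Sigma V^T$, $U\in\mathbb{R}^{m\times m}$ and $V\in\mathbb{R}^{n\times n}$ are orthogonal and $\Sigma\in\mathbb{R}^{m\times n}$ is (rectangular) diagonal with diagonal entries the singular values of $Y$ in nonincreasing order. Assumption 1. Penalty functions $\phi(\cdot\,;a)\colon\mathbb{R}\to\mathbb{R}$ are parameterized by a real number $a\geq 0$. "Non-convex penalty function" is the name used for a function satisfying the following properties (the case $a=0$, e.g. $\phi(x;0)=|x|$, is allowed); primes denote derivatives in $x$: 1. $\phi$ is continuous on $\mathbb{R}$, continuously differentiable on $\mathbb{R}\setminus\{0\}$,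 and symmetric, i.e. $\phi(-x;a)=\phi(x;a)$; 2. $\phi'(x;a)\geq 0$ for all $x>0$; 3. $\phi''(x;a)\leq 0$ for all $x>0$; 4. $\phi'(0^+;a)=1$; 5. $\inf_{x\neq 0}\phi''(x;a)=\phi''(0^+;a)=-a$. Proximal operator. For $y\in\mathbb{R}$, $$\Theta(y;\lambda,a):=\arg\min_{x\in\mathbb{R}}\left\{\frac{1}{2}(y-x)^2+\lambda\phi(x;a)\right\}.$$ For a matrix argument, $\Theta(\cdot\,;\lambda,a)$ is applied element-wise. *)

theory Defs
  imports "HOL-Analysis.Derivative" "Jordan_Normal_Form.Char_Poly"
begin

text \<open>
  The list of the min(m,n) singular values of a real m x n matrix, in nonincreasing order and with
  multiplicity: the square roots of the eigenvalues of the n x n matrix X^T X. If n > m, the n - m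
  entries cut off by \<^const>\<open>take\<close> are zeros, since X^T X has rank at most m.
  Indices start at 0, so entry i is the (i+1)-st singular value.
\<close>

definition singular_values :: "real mat \<Rightarrow> real list" where
  "singular_values X =
     take (min (dim_row X) (dim_col X))
       (rev (sorted_list_of_multiset (image_mset sqrt (proots (char_poly (transpose_mat X * X))))))"

definition singular_value :: "nat \<Rightarrow> real mat \<Rightarrow> real" where
  "singular_value i X = singular_values X ! i"

definition frobenius_norm :: "real mat \<Rightarrow> real" where
  "frobenius_norm X = sqrt (\<Sum>i<dim_row X. \<Sum>j<dim_col X. (X $$ (i, j))\<^sup>2)"

text \<open>
  Orthogonality in the usual sense. The library's \<^const>\<open>orthogonal_mat\<close> does not normalise the columns.
\<close>

definition orthonormal_mat :: "nat \<Rightarrow> real mat \<Rightarrow> bool" where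
  "orthonormal_mat n U \<longleftrightarrow> U \<in> carrier_mat n n \<and>
     transpose_mat U * U = 1\<^sub>m n \<and> U * transpose_mat U = 1\<^sub>m n"

definition is_svd :: "nat \<Rightarrow> nat \<Rightarrow> real mat \<Rightarrow> real mat \<Rightarrow> real mat \<Rightarrow> real mat \<Rightarrow> bool" where
  "is_svd m n Y U S V \<longleftrightarrow>
     orthonormal_mat m U \<and> orthonormal_mat n V \<and>
     S \<in> carrier_mat m n \<and> diagonal_mat S \<and>
     (\<forall>i < min m n. S $$ (i, i) = singular_value i Y) \<and>
     Y = U * S * transpose_mat V"

text \<open>
  The function argument is the penalty with its parameter \<open>a\<close> already fixed. Since \<^const>\<open>deriv\<close> is
  total, differentiability is stated explicitly; the second derivative has to exist off 0 for the
  last two clauses to make sense. \<^const>\<open>bdd_below\<close> is needed because the infimum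
  of an unbounded set of reals is unspecified.
\<close>

definition nonconvex_penalty :: "(real \<Rightarrow> real) \<Rightarrow> real \<Rightarrow> bool" where
  "nonconvex_penalty \<phi> a \<longleftrightarrow>
     continuous_on UNIV \<phi> \<and>
     (\<forall>x. x \<noteq> 0 \<longrightarrow> \<phi> differentiable (at x)) \<and>
     continuous_on (- {0}) (deriv \<phi>) \<and>
     (\<forall>x. x \<noteq> 0 \<longrightarrow> deriv \<phi> differentiable (at x)) \<and>
     (\<forall>x. \<phi> (- x) = \<phi> x) \<and>
     (\<forall>x>0. deriv \<phi> x \<ge> 0) \<and>
     (\<forall>x>0. deriv (deriv \<phi>) x \<le> 0) \<and>
     (deriv \<phi> \<longlongrightarrow> 1) (at_right 0) \<and>
     bdd_below (deriv (deriv \<phi>) ` (- {0})) \<and>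
     (INF x\<in>- {0}. deriv (deriv \<phi>) x) = - a \<and>
     (deriv (deriv \<phi>) \<longlongrightarrow> - a) (at_right 0)"

text \<open>
  \<^const>\<open>arg_min\<close> picks some minimiser; for \<open>0 \<le> a < 1/lam\<close> the objective is strictly convex and
  coercive, so there is exactly one.
\<close>

definition prox :: "(real \<Rightarrow> real) \<Rightarrow> real \<Rightarrow> real \<Rightarrow> real" where
  "prox \<phi> lam y = (ARG_MIN (\<lambda>x. 1 / 2 * (y - x)\<^sup>2 + lam * \<phi> x) x. True)"

definition objective :: "(real \<Rightarrow> real) \<Rightarrow> real \<Rightarrow> real mat \<Rightarrow> real mat \<Rightarrow> real" where
  "objective \<phi> lam Y X =
     1 / 2 * (frobenius_norm (Y - X))\<^sup>2 +
     lam * (\<Sum>i < min (dim_row X) (dim_col X). \<phi> (singular_value i X))"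

end

(*
  Since the Frobenius norm and the singular values are invariant under orthogonal factors, X may be
  replaced by Z = U^T X V and Y by the diagonal matrix S. Put mu = 1 - lam a > 0. The function
  h(x) = lam (a/2 x^2 + phi(x)) is even and convex, and x_i = prox(S_ii) minimises
  mu/2 x^2 - S_ii x + h(x), so that s_i = S_ii - mu x_i is a subgradient of h at x_i. Both x_i and
  s_i are nonnegative and nonincreasing in i. Writing S = mu P + diag(s) with P = diag(x), von
  Neumann's trace inequality (sum of s_i Z_ii) <= (sum of s_i sigma_i(Z)) together with the
  subgradient inequalities gives
    Psi(Z) >= Psi(P) + mu/2 |Z - P|^2,
  hence minimality and, without the equality case of the trace inequality, uniqueness.
  In the trace inequality, Z_ii is expanded in singular vectors of Z; by AM-GM and Bessel the
  coefficients are dominated by a doubly substochastic matrix, and Abel summation concludes.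
*)

theory Submission
  imports Defs
begin

section \<open>Convexity and the proximal operator\<close>

text \<open>Shifting both points by \<open>e > 0\<close> moves them into the open half-line. The
  convexity inequality there passes to the limit \<open>e\<close> to 0 from the right by
  continuity.\<close>

lemma convex_on_atLeast_of_greaterThan:
  fixes g :: "real \<Rightarrow> real"
  assumes cont: "continuous_on UNIV g" and cvx: "convex_on {0<..} g"
  shows "convex_on {0..} g"
proof (rule convex_onI)
  fix t x y :: real
  assume t: "0 < t" "t < 1" and x: "x \<in> {0..}" and y: "y \<in> {0..}"
  have "g ((1 - t) *\<^sub>R (x + e) + t *\<^sub>R (y + e)) \<le> (1 - t) * g (x + e) + t * g (y + e)"
    if "0 < e" for e
    using convex_onD[OF cvx, of t "x + e" "y + e"] t x y that by auto
  then have ev: "\<forall>\<^sub>F e in at_right 0.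
      g ((1 - t) *\<^sub>R (x + e) + t *\<^sub>R (y + e)) \<le> (1 - t) * g (x + e) + t * g (y + e)"
    by (auto simp: eventually_at_filter intro!: always_eventually)
  have c: "isCont g z" for z
    using cont by (simp add: continuous_on_eq_continuous_at)
  have l: "((\<lambda>e. g (f e)) \<longlongrightarrow> g (f 0)) (at_right 0)" if "isCont f 0" for f :: "real \<Rightarrow> real"
    using isCont_o2[OF that c] by (auto simp: continuous_within intro: tendsto_within_subset)
  show "g ((1 - t) *\<^sub>R x + t *\<^sub>R y) \<le> (1 - t) * g x + t * g y"
  proof (rule tendsto_le[OF _ _ _ ev])
    show "((\<lambda>e. g ((1 - t) *\<^sub>R (x + e) + t *\<^sub>R (y + e))) \<longlongrightarrow> g ((1 - t) *\<^sub>R x + t *\<^sub>R y)) (at_right 0)"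
      using l[of "\<lambda>e. (1 - t) *\<^sub>R (x + e) + t *\<^sub>R (y + e)"] by (auto intro!: continuous_intros)
    show "((\<lambda>e. (1 - t) * g (x + e) + t * g (y + e)) \<longlongrightarrow> (1 - t) * g x + t * g y) (at_right 0)"
      using l[of "\<lambda>e. x + e"] l[of "\<lambda>e. y + e"] by (auto intro!: tendsto_intros continuous_intros)
  qed auto
qed auto

text \<open>An even function depends only on the absolute value. The triangle inequality moves a
  convex combination to one of absolute values, monotonicity keeps the inequality, and convexity on
  the half-line finishes.\<close>

lemma convex_on_even:
  fixes g :: "real \<Rightarrow> real"
  assumes even: "\<And>x. g (- x) = g x" and mono: "mono_on {0..} g" and cvx: "convex_on {0..} g"
  shows "convex_on UNIV g"
proof (rule convex_onI)
  fix t x y :: real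
  assume t: "0 < t" "t < 1"
  have abs: "g z = g \<bar>z\<bar>" for z using even by (auto simp: abs_if)
  have "g ((1 - t) *\<^sub>R x + t *\<^sub>R y) = g \<bar>(1 - t) *\<^sub>R x + t *\<^sub>R y\<bar>" by (rule abs)
  also have "\<dots> \<le> g ((1 - t) *\<^sub>R \<bar>x\<bar> + t *\<^sub>R \<bar>y\<bar>)"
  proof (rule mono_onD[OF mono])
    show "\<bar>(1 - t) *\<^sub>R x + t *\<^sub>R y\<bar> \<le> (1 - t) *\<^sub>R \<bar>x\<bar> + t *\<^sub>R \<bar>y\<bar>"
      using abs_triangle_ineq[of "(1 - t) * x" "t * y"] t by (simp add: abs_mult)
  qed (use t in auto)
  also have "\<dots> \<le> (1 - t) * g \<bar>x\<bar> + t * g \<bar>y\<bar>"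
    using convex_onD[OF cvx, of t "\<bar>x\<bar>" "\<bar>y\<bar>"] t by auto
  finally show "g ((1 - t) *\<^sub>R x + t *\<^sub>R y) \<le> (1 - t) * g x + t * g y"
    using abs[of x] abs[of y] by simp
qed auto

text \<open>For positive x the second derivative of \<open>g\<close> is a plus that of
  \<open>\<phi>\<close>, hence nonnegative because -a is the infimum of the latter; the first
  derivative is nonnegative too. The kink at 0 is never differentiated: continuity carries convexity
  to 0, and evenness with monotonicity carries it across.\<close>

lemma nonconvex_penalty_convex:
  assumes pen: "nonconvex_penalty \<phi> a" and a: "0 \<le> a"
  defines "g \<equiv> \<lambda>x. a / 2 * x\<^sup>2 + \<phi> x"
  shows "continuous_on UNIV g" and "g (- x) = g x" and "mono_on {0..} g" and "convex_on UNIV g"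
proof -
  note p = pen[unfolded nonconvex_penalty_def]
  show cont: "continuous_on UNIV g"
    unfolding g_def using p by (auto intro!: continuous_intros)
  show even: "g (- x) = g x" for x
    unfolding g_def using p by simp
  have d1: "(g has_real_derivative a * x + deriv \<phi> x) (at x)" if "x > 0" for x
  proof -
    have "(\<phi> has_real_derivative deriv \<phi> x) (at x)"
      using p that by (simp add: DERIV_deriv_iff_real_differentiable)
    then show ?thesis unfolding g_def by (auto intro!: derivative_eq_intros)
  qed
  have d2: "((\<lambda>x. a * x + deriv \<phi> x) has_real_derivative a + deriv (deriv \<phi>) x) (at x)" if "x > 0" for x
  proof -
    have "(deriv \<phi> has_real_derivative deriv (deriv \<phi>) x) (at x)"
      using p that by (simp add: DERIV_deriv_iff_real_differentiable)
    then show ?thesis by (auto intro!: derivative_eq_intros)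
  qed
  have d2_ge: "a + deriv (deriv \<phi>) x \<ge> 0" if "x > 0" for x
  proof -
    have "(INF x\<in>- {0}. deriv (deriv \<phi>) x) \<le> deriv (deriv \<phi>) x"
      using p that by (intro cINF_lower) auto
    then show ?thesis using p by simp
  qed
  have "convex_on {0<..} g"
    by (rule f''_ge0_imp_convex[OF _ d1 d2 d2_ge]) auto
  then have cvx: "convex_on {0..} g"
    by (rule convex_on_atLeast_of_greaterThan[OF cont])
  show mono: "mono_on {0..} g"
  proof (rule mono_onI)
    fix x y :: real
    assume x: "x \<in> {0..}" "x \<le> y"
    show "g x \<le> g y"
    proof (rule DERIV_nonneg_imp_increasing_open[OF \<open>x \<le> y\<close>])
      show "\<exists>D. DERIV g z :> D \<and> 0 \<le> D" if "x < z" "z < y" for z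
        using d1[of z] that x p a by (intro exI[of _ "a * z + deriv \<phi> z"]) auto
      show "continuous_on {x..y} g" using cont continuous_on_subset by blast
    qed
  qed
  show "convex_on UNIV g" by (rule convex_on_even[OF even mono cvx])
qed

text \<open>Compare \<open>u\<close> with the point \<open>u + t * d\<close> on the way to
  \<open>x\<close>. Convexity bounds \<open>h\<close> there linearly in \<open>t\<close>; after
  division by \<open>t\<close> the quadratic part contributes only a term of order \<open>t\<close>,
  which vanishes in the limit.\<close>

lemma minimizer_subgradient:
  fixes h :: "real \<Rightarrow> real"
  assumes cvx: "convex_on UNIV h"
    and min: "\<And>x. \<mu> / 2 * u\<^sup>2 - y * u + h u \<le> \<mu> / 2 * x\<^sup>2 - y * x + h x"
  shows "h u + (y - \<mu> * u) * (x - u) \<le> h x"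
proof -
  define d where "d = x - u"
  define c where "c = h x - h u - (y - \<mu> * u) * d"
  have "0 \<le> c + t * (\<mu> / 2 * d\<^sup>2)" if t: "0 < t" "t < 1" for t
  proof -
    have eq: "(1 - t) *\<^sub>R u + t *\<^sub>R x = u + t * d" by (simp add: d_def algebra_simps)
    have "h (u + t * d) \<le> (1 - t) * h u + t * h x"
      using convex_onD[OF cvx, of t u x] t unfolding eq by auto
    then have "0 \<le> t * (c + t * (\<mu> / 2 * d\<^sup>2))"
      using min[of "u + t * d"] by (simp add: c_def algebra_simps power2_eq_square)
    then show ?thesis using t by (simp add: zero_le_mult_iff)
  qed
  then have "\<forall>\<^sub>F t in at_right 0. 0 \<le> c + t * (\<mu> / 2 * d\<^sup>2)"
    by (auto simp: eventually_at_right_field intro!: exI[of _ 1])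
  moreover have "((\<lambda>t. c + t * (\<mu> / 2 * d\<^sup>2)) \<longlongrightarrow> c + 0 * (\<mu> / 2 * d\<^sup>2)) (at_right 0)"
    by (intro tendsto_intros)
  ultimately have "0 \<le> c + 0 * (\<mu> / 2 * d\<^sup>2)"
    by (intro tendsto_lowerbound) auto
  then show ?thesis by (simp add: c_def d_def)
qed

text \<open>Inside a compact interval continuity yields a minimizer. Outside it the value at 0 is
  already at least as good, since \<open>h\<close> is smallest at 0 and the quadratic term outweighs
  the linear one.\<close>

lemma quadratic_plus_even_attains_min:
  fixes h :: "real \<Rightarrow> real"
  assumes cont: "continuous_on UNIV h" and even: "\<And>x. h (- x) = h x" and mono: "mono_on {0..} h"
    and \<mu>: "\<mu> > 0"
  shows "\<exists>u. \<forall>x. \<mu> / 2 * u\<^sup>2 - y * u + h u \<le> \<mu> / 2 * x\<^sup>2 - y * x + h x"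
proof -
  let ?F = "\<lambda>x. \<mu> / 2 * x\<^sup>2 - y * x + h x"
  \<comment> \<open>The larger root in modulus of the polynomial part: beyond this radius
    \<open>y * x\<close> is at most \<open>\<mu> / 2 * x\<^sup>2\<close>.\<close>
  let ?r = "2 * \<bar>y\<bar> / \<mu>"
  have r: "0 \<le> ?r" using \<mu> by simp
  have "\<exists>u\<in>{- ?r..?r}. \<forall>x\<in>{- ?r..?r}. ?F u \<le> ?F x"
    by (rule continuous_attains_inf)
      (use r in \<open>auto intro!: continuous_intros continuous_on_subset[OF cont]\<close>)
  then obtain u where u: "\<And>x. x \<in> {- ?r..?r} \<Longrightarrow> ?F u \<le> ?F x" by blast
  have h0: "h 0 \<le> h x" for x
    using mono_onD[OF mono, of 0 "\<bar>x\<bar>"] even[of x] by (cases "x < 0") auto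
  have "?F u \<le> ?F x" for x
  proof (cases "x \<in> {- ?r..?r}")
    case False
    then have "?r < \<bar>x\<bar>" by auto
    then have "2 * \<bar>y\<bar> < \<mu> * \<bar>x\<bar>" using \<mu> by (simp add: field_simps)
    then have "2 * \<bar>y\<bar> * \<bar>x\<bar> \<le> \<mu> * \<bar>x\<bar> * \<bar>x\<bar>" by (intro mult_right_mono) auto
    then have "y * x \<le> \<mu> / 2 * x\<^sup>2"
      using abs_ge_self[of "y * x"] by (simp add: abs_mult power2_eq_square mult.assoc)
    then have "?F 0 \<le> ?F x" using h0[of x] by simp
    moreover have "?F u \<le> ?F 0" using r by (intro u) auto
    ultimately show ?thesis by linarith
  qed (rule u)
  then show ?thesis by blast
qed

text \<open>Moving the quadratic \<open>lam * a / 2 * x\<^sup>2\<close> from the data term into the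
  penalty makes the penalty convex and leaves the positive coefficient \<open>\<mu>\<close> on the
  remaining square. The first-order condition for \<open>prox\<close> then reads as a subgradient
  inequality for \<open>h\<close>.\<close>

lemma prox_subgradient:
  assumes pen: "nonconvex_penalty \<phi> a" and a: "0 \<le> a" and lam: "0 < lam" "a < 1 / lam"
  defines "h \<equiv> \<lambda>x. lam * (a / 2 * x\<^sup>2 + \<phi> x)" and "\<mu> \<equiv> 1 - lam * a"
  shows "0 < \<mu>"
    and "h (prox \<phi> lam y) + (y - \<mu> * prox \<phi> lam y) * (x - prox \<phi> lam y) \<le> h x"
proof -
  let ?g = "\<lambda>x. a / 2 * x\<^sup>2 + \<phi> x"
  note g = nonconvex_penalty_convex[OF pen a]
  show \<mu>: "0 < \<mu>" using lam by (simp add: \<mu>_def field_simps)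
  have h: "continuous_on UNIV h" "convex_on UNIV h" "mono_on {0..} h" "\<And>x. h (- x) = h x"
    unfolding h_def using lam g(2)
    by (simp_all only: continuous_on_mult_left[OF g(1)] convex_on_cmul[OF less_imp_le g(4)])
      (auto intro!: mono_onI mult_left_mono mono_onD[OF g(3)] simp del: times_divide_eq_left)
  have eq: "1 / 2 * (y - x)\<^sup>2 + lam * \<phi> x = \<mu> / 2 * x\<^sup>2 - y * x + h x + y\<^sup>2 / 2" for x
    by (simp add: h_def \<mu>_def power2_eq_square field_simps)
  obtain u where u: "\<And>x. \<mu> / 2 * u\<^sup>2 - y * u + h u \<le> \<mu> / 2 * x\<^sup>2 - y * x + h x"
    using quadratic_plus_even_attains_min[OF h(1) h(4) h(3) \<mu>, of y] by blast
  \<comment> \<open>\<open>prox\<close> is a choice, so it is known to be a minimizer only once some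
    minimizer \<open>u\<close> exists.\<close>
  have "is_arg_min (\<lambda>x. 1 / 2 * (y - x)\<^sup>2 + lam * \<phi> x) (\<lambda>x. True) (prox \<phi> lam y)"
    unfolding prox_def arg_min_def
    unfolding eq by (rule someI[of _ u]) (use u in \<open>auto simp: is_arg_min_def not_less\<close>)
  then have "\<And>x. \<mu> / 2 * (prox \<phi> lam y)\<^sup>2 - y * prox \<phi> lam y + h (prox \<phi> lam y) \<le> \<mu> / 2 * x\<^sup>2 - y * x + h x"
    unfolding eq by (auto simp: is_arg_min_def not_less)
  from minimizer_subgradient[OF h(2) this]
  show "h (prox \<phi> lam y) + (y - \<mu> * prox \<phi> lam y) * (x - prox \<phi> lam y) \<le> h x" .
qed

text \<open>Subgradients of a convex function are monotone, so \<open>p\<close> and \<open>s\<close>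
  cannot move in opposite directions. As y is the sum of \<open>\<mu> * p y\<close> and
  \<open>s y\<close>, a strict decrease of one of them would make y decrease. The signs follow by
  comparison with y = 0.\<close>

lemma prox_order:
  assumes pen: "nonconvex_penalty \<phi> a" and a: "0 \<le> a" and lam: "0 < lam" "a < 1 / lam"
  defines "p \<equiv> prox \<phi> lam" and "\<mu> \<equiv> 1 - lam * a"
  shows "p 0 = 0" and "0 \<le> y \<Longrightarrow> 0 \<le> p y" and "0 \<le> y \<Longrightarrow> 0 \<le> y - \<mu> * p y"
    and "y' \<le> y \<Longrightarrow> p y' \<le> p y" and "y' \<le> y \<Longrightarrow> y' - \<mu> * p y' \<le> y - \<mu> * p y"
proof -
  define h where "h = (\<lambda>x. lam * (a / 2 * x\<^sup>2 + \<phi> x))"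
  define s where "s y = y - \<mu> * p y" for y
  have \<mu>: "0 < \<mu>" and sub: "\<And>x y. h (p y) + s y * (x - p y) \<le> h x"
    using prox_subgradient[OF pen a lam] unfolding h_def s_def \<mu>_def p_def by auto
  have even: "h (- x) = h x" for x using pen by (simp add: h_def nonconvex_penalty_def)
  \<comment> \<open>Testing the subgradient inequality at the mirror point \<open>- p y\<close>
    cancels the two equal values of \<open>h\<close>.\<close>
  have sp: "0 \<le> s y * p y" for y using sub[of y "- p y"] by (simp add: even algebra_simps)
  have "\<mu> * (p 0)\<^sup>2 \<le> 0" using sp[of 0] by (simp add: s_def power2_eq_square mult.assoc)
  then show p0: "p 0 = 0" using \<mu> by (simp add: mult_le_0_iff)
  have diff: "0 \<le> (s y - s y') * (p y - p y')" for y y'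
    using sub[of y "p y'"] sub[of y' "p y"] by (simp add: algebra_simps)
  have y: "y = \<mu> * p y + s y" for y by (simp add: s_def)
  show mono: "p y' \<le> p y" if "y' \<le> y" for y y'
  proof (rule ccontr)
    assume "\<not> p y' \<le> p y"
    moreover from this have "s y \<le> s y'" using diff[of y y'] by (auto simp: zero_le_mult_iff)
    moreover from calculation have "\<mu> * p y < \<mu> * p y'" using \<mu> by simp
    ultimately show False using that y[of y] y[of y'] by linarith
  qed
  show smono: "y' - \<mu> * p y' \<le> y - \<mu> * p y" if "y' \<le> y" for y y'
  proof (rule ccontr)
    assume "\<not> ?thesis"
    then have s: "s y < s y'" by (simp add: s_def)
    then have "p y \<le> p y'" using diff[of y y'] by (auto simp: zero_le_mult_iff)
    then have "\<mu> * p y \<le> \<mu> * p y'" using \<mu> by simp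
    with s mono[OF that] show False using that y[of y] y[of y'] \<open>p y \<le> p y'\<close> by (smt (verit))
  qed
  show "0 \<le> y \<Longrightarrow> 0 \<le> p y" using mono[of 0 y] p0 by simp
  show "0 \<le> y \<Longrightarrow> 0 \<le> y - \<mu> * p y" using smono[of 0 y] p0 by simp
qed

section \<open>Doubly substochastic weights\<close>

text \<open>Abel summation: nonnegative nonincreasing weights preserve an inequality between all
  partial sums.\<close>

lemma sum_mult_antimono_mono:
  fixes s f g :: "nat \<Rightarrow> real"
  assumes s: "\<And>i. i < k \<Longrightarrow> 0 \<le> s i" "\<And>i j. i \<le> j \<Longrightarrow> j < k \<Longrightarrow> s j \<le> s i"
    and le: "\<And>p. p < k \<Longrightarrow> (\<Sum>i<Suc p. f i) \<le> (\<Sum>i<Suc p. g i)"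
  shows "(\<Sum>i<k. s i * f i) \<le> (\<Sum>i<k. s i * g i)"
proof -
  define d where "d i = g i - f i" for i
  have D: "0 \<le> (\<Sum>i<Suc p. d i)" if "p < k" for p
    using le[OF that] by (simp add: d_def sum_subtractf)
  \<comment> \<open>The induction invariant keeps the last weight as a common factor. Lowering it to
    the next weight is harmless because the partial sum of \<open>d\<close> is nonnegative.\<close>
  have partial: "s p * (\<Sum>i<Suc p. d i) \<le> (\<Sum>i<Suc p. s i * d i)" if "p < k" for p
    using that
  proof (induction p)
    case (Suc p)
    have "s (Suc p) * (\<Sum>i<Suc p. d i) \<le> s p * (\<Sum>i<Suc p. d i)"
      using s(2)[of p "Suc p"] D[of p] Suc.prems by (intro mult_right_mono) auto
    also have "\<dots> \<le> (\<Sum>i<Suc p. s i * d i)" using Suc by simp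
    finally show ?case
      by (subst (1 2) sum.lessThan_Suc) (simp add: distrib_left)
  qed simp
  have "0 \<le> (\<Sum>i<k. s i * d i)"
  proof (cases k)
    case (Suc p)
    have "0 \<le> s p * (\<Sum>i<Suc p. d i)" using s(1)[of p] D[of p] Suc by (intro mult_nonneg_nonneg) auto
    also have "\<dots> \<le> (\<Sum>i<Suc p. s i * d i)" by (rule partial) (simp add: Suc)
    finally show ?thesis using Suc by simp
  qed simp
  then show ?thesis by (simp add: d_def right_diff_distrib sum_subtractf)
qed

text \<open>Abel summation is applied twice. With weights \<open>s\<close> it reduces the claim to
  the first p + 1 rows; with weights \<open>t\<close> it then compares the column sums of these rows
  with the indicator of the first p + 1 columns.\<close>

lemma substochastic_sum_le:
  fixes s t :: "nat \<Rightarrow> real" and w :: "nat \<Rightarrow> nat \<Rightarrow> real"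
  assumes s: "\<And>i. i < k \<Longrightarrow> 0 \<le> s i" "\<And>i j. i \<le> j \<Longrightarrow> j < k \<Longrightarrow> s j \<le> s i"
    and t: "\<And>i. i < n \<Longrightarrow> 0 \<le> t i" "\<And>i j. i \<le> j \<Longrightarrow> j < n \<Longrightarrow> t j \<le> t i"
    and w: "\<And>i j. i < k \<Longrightarrow> j < n \<Longrightarrow> 0 \<le> w i j"
    and row: "\<And>i. i < k \<Longrightarrow> (\<Sum>j<n. w i j) \<le> 1" and col: "\<And>j. j < n \<Longrightarrow> (\<Sum>i<k. w i j) \<le> 1"
    and kn: "k \<le> n"
  shows "(\<Sum>i<k. s i * (\<Sum>j<n. t j * w i j)) \<le> (\<Sum>i<k. s i * t i)"
proof (rule sum_mult_antimono_mono[OF s])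
  fix p assume p: "p < k"
  have "(\<Sum>i<Suc p. \<Sum>j<n. t j * w i j) = (\<Sum>j<n. t j * (\<Sum>i<Suc p. w i j))"
    by (subst sum.swap) (simp add: sum_distrib_left del: sum.lessThan_Suc)
  also have "\<dots> \<le> (\<Sum>j<n. t j * (if j < Suc p then 1 else 0))"
  proof (rule sum_mult_antimono_mono[OF t])
    fix q assume q: "q < n"
    \<comment> \<open>The leading block has total weight at most its number of rows and at most its
      number of columns. The case split takes the smaller count.\<close>
    have "(\<Sum>j<Suc q. \<Sum>i<Suc p. w i j) \<le> real (min (Suc p) (Suc q))"
    proof (cases "p \<le> q")
      case True
      have "(\<Sum>j<Suc q. \<Sum>i<Suc p. w i j) = (\<Sum>i<Suc p. \<Sum>j<Suc q. w i j)" by (rule sum.swap)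
      also have "\<dots> \<le> (\<Sum>i<Suc p. \<Sum>j<n. w i j)"
        by (intro sum_mono sum_mono2) (use p q w in auto)
      also have "\<dots> \<le> (\<Sum>i<Suc p. 1)" by (intro sum_mono row) (use p in auto)
      finally show ?thesis using True by simp
    next
      case False
      have "(\<Sum>j<Suc q. \<Sum>i<Suc p. w i j) \<le> (\<Sum>j<Suc q. \<Sum>i<k. w i j)"
        by (intro sum_mono sum_mono2) (use p q w in auto)
      also have "\<dots> \<le> (\<Sum>j<Suc q. 1)" by (intro sum_mono col) (use q in auto)
      finally show ?thesis using False by simp
    qed
    also have "real (min (Suc p) (Suc q)) = (\<Sum>j<Suc q. if j < Suc p then 1 else 0)"
    proof -
      have "{..<Suc q} \<inter> {j. j < Suc p} = {..<min (Suc p) (Suc q)}" by auto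
      then show ?thesis by (simp add: sum.If_cases del: lessThan_Suc sum.lessThan_Suc)
    qed
    finally show "(\<Sum>j<Suc q. \<Sum>i<Suc p. w i j) \<le> (\<Sum>j<Suc q. if j < Suc p then 1 else 0)" .
  qed
  also have "\<dots> = (\<Sum>j<Suc p. t j)"
  proof -
    have "{..<n} \<inter> {j. j < Suc p} = {..<Suc p}" using p kn by auto
    then show ?thesis by (simp add: if_distrib[of "(*) _"] sum.If_cases del: lessThan_Suc cong: if_cong)
  qed
  finally show "(\<Sum>i<Suc p. \<Sum>j<n. t j * w i j) \<le> (\<Sum>j<Suc p. t j)" .
qed

text \<open>The columns of \<open>c\<close> satisfying \<open>P\<close> are orthonormal and the
  others vanish, so this is Bessel's inequality for the i-th unit vector.\<close>

lemma orthonormal_or_zero_row_le: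
  fixes c :: "nat \<Rightarrow> nat \<Rightarrow> real"
  assumes orth: "\<And>j l. j < n \<Longrightarrow> l < n \<Longrightarrow>
      (\<Sum>i<m. c i j * c i l) = (if j = l \<and> P j then 1 else 0)"
    and i: "i < m"
  shows "(\<Sum>j<n. (c i j)\<^sup>2) \<le> 1"
proof -
  define r where "r = (\<Sum>j<n. (c i j)\<^sup>2)"
  \<comment> \<open>The projection of the i-th unit vector onto the span of the columns. Its squared
    length and its i-th coordinate both equal \<open>r\<close>, so its squared distance from the
    unit vector is 1 - r.\<close>
  define v where "v l = (\<Sum>j<n. c i j * c l j)" for l
  have zero: "c i j = 0" if "j < n" "\<not> P j" for j
  proof -
    have "(\<Sum>l<m. c l j * c l j) = 0" using orth[of j j] that by simp
    then show ?thesis using i by (simp add: sum_nonneg_eq_0_iff)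
  qed
  have "(\<Sum>l<m. (v l)\<^sup>2) = (\<Sum>l<m. \<Sum>j<n. \<Sum>q<n. c i j * c i q * (c l j * c l q))"
    by (simp add: v_def power2_eq_square sum_product algebra_simps)
  also have "\<dots> = (\<Sum>j<n. \<Sum>q<n. c i j * c i q * (\<Sum>l<m. c l j * c l q))"
    by (subst sum.swap, rule sum.cong[OF refl], subst sum.swap) (simp add: sum_distrib_left)
  also have "\<dots> = (\<Sum>j<n. \<Sum>q<n. if j = q then (if P j then (c i j)\<^sup>2 else 0) else 0)"
    by (intro sum.cong refl) (auto simp: orth power2_eq_square)
  also have "\<dots> = r"
    using zero by (auto simp: r_def intro!: sum.cong)
  finally have vv: "(\<Sum>l<m. (v l)\<^sup>2) = r" .
  have "0 \<le> (\<Sum>l<m. ((if l = i then 1 else 0) - v l)\<^sup>2)" by (intro sum_nonneg) auto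
  also have "\<dots> = (\<Sum>l<m. (if l = i then 1 else 0) - 2 * (if l = i then v l else 0) + (v l)\<^sup>2)"
    by (intro sum.cong) (auto simp: power2_eq_square algebra_simps)
  also have "\<dots> = 1 - 2 * v i + r"
    using i by (simp add: sum.distrib sum_subtractf vv flip: sum_distrib_left)
  also have "v i = r" by (simp add: v_def r_def power2_eq_square)
  finally show ?thesis by (simp add: r_def)
qed

text \<open>Scaling the columns of \<open>C\<close> to length 1 pulls out the factor
  \<open>t j\<close>. By AM-GM the remaining products are at most \<open>w\<close>, the mean of two
  arrays of squares, and Bessel's inequality together with the bounds on \<open>Q\<close> makes
  \<open>w\<close> doubly substochastic.\<close>

lemma von_neumann_trace_sum:
  fixes C Q :: "nat \<Rightarrow> nat \<Rightarrow> real"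
  assumes C: "\<And>j l. j < n \<Longrightarrow> l < n \<Longrightarrow> (\<Sum>i<m. C i j * C i l) = (if j = l then (t j)\<^sup>2 else 0)"
    and Q: "\<And>j. j < n \<Longrightarrow> (\<Sum>i<n. (Q j i)\<^sup>2) \<le> 1" "\<And>i. i < n \<Longrightarrow> (\<Sum>j<n. (Q j i)\<^sup>2) \<le> 1"
    and s: "\<And>i. i < k \<Longrightarrow> 0 \<le> s i" "\<And>i j. i \<le> j \<Longrightarrow> j < k \<Longrightarrow> s j \<le> s i"
    and t: "\<And>i. i < n \<Longrightarrow> 0 \<le> t i" "\<And>i j. i \<le> j \<Longrightarrow> j < n \<Longrightarrow> t j \<le> t i"
    and k: "k \<le> m" "k \<le> n"
  shows "(\<Sum>i<k. s i * (\<Sum>j<n. C i j * Q j i)) \<le> (\<Sum>i<k. s i * t i)"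
proof -
  \<comment> \<open>For \<open>t j = 0\<close> division by zero makes the column vanish, which is
    the second alternative in \<open>orth\<close>.\<close>
  define c where "c i j = C i j / t j" for i j
  have C_eq: "C i j = t j * c i j" if "i < m" "j < n" for i j
  proof (cases "t j = 0")
    case True
    then have "(\<Sum>i<m. C i j * C i j) = 0" using C[of j j] that by simp
    then show ?thesis using that True by (simp add: sum_nonneg_eq_0_iff)
  qed (simp add: c_def)
  have orth: "(\<Sum>i<m. c i j * c i l) = (if j = l \<and> t j \<noteq> 0 then 1 else 0)" if "j < n" "l < n" for j l
  proof -
    have "(\<Sum>i<m. c i j * c i l) = (\<Sum>i<m. C i j * C i l) / (t j * t l)"
      by (simp add: c_def sum_divide_distrib)
    then show ?thesis using C[OF that] by (auto simp: power2_eq_square)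
  qed
  define w where "w i j = ((c i j)\<^sup>2 + (Q j i)\<^sup>2) / 2" for i j
  have "(\<Sum>i<k. s i * (\<Sum>j<n. C i j * Q j i)) \<le> (\<Sum>i<k. s i * (\<Sum>j<n. t j * w i j))"
  proof (intro sum_mono mult_left_mono)
    fix i j assume i: "i \<in> {..<k}" and j: "j \<in> {..<n}"
    have "c i j * Q j i \<le> w i j"
      using sum_squares_bound[of "c i j" "Q j i"] by (simp add: w_def)
    then have "t j * (c i j * Q j i) \<le> t j * w i j" using t(1)[of j] j by (intro mult_left_mono) auto
    then show "C i j * Q j i \<le> t j * w i j" using C_eq[of i j] i j k by simp
  qed (use s in auto)
  also have "\<dots> \<le> (\<Sum>i<k. s i * t i)"
  proof (rule substochastic_sum_le[OF s t _ _ _ k(2)])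
    show "(\<Sum>j<n. w i j) \<le> 1" if "i < k" for i
    proof -
      have "(\<Sum>j<n. (c i j)\<^sup>2) \<le> 1"
        by (rule orthonormal_or_zero_row_le[where m = m and P = "\<lambda>j. t j \<noteq> 0"]) (use orth that k in auto)
      then show ?thesis
        using Q(2)[of i] that k by (simp add: w_def sum.distrib flip: sum_divide_distrib)
    qed
    show "(\<Sum>i<k. w i j) \<le> 1" if "j < n" for j
    proof -
      have "(\<Sum>i<k. (c i j)\<^sup>2) \<le> (\<Sum>i<m. (c i j)\<^sup>2)" using k by (intro sum_mono2) auto
      also have "\<dots> \<le> 1" using orth[of j j] that by (simp add: power2_eq_square)
      finally have "(\<Sum>i<k. (c i j)\<^sup>2) \<le> 1" .
      moreover have "(\<Sum>i<k. (Q j i)\<^sup>2) \<le> (\<Sum>i<n. (Q j i)\<^sup>2)" using k by (intro sum_mono2) auto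
      ultimately show ?thesis
        using Q(1)[OF that] by (simp add: w_def sum.distrib flip: sum_divide_distrib)
    qed
  qed (auto simp: w_def)
  finally show ?thesis .
qed

section \<open>Orthogonal diagonalization of real symmetric matrices\<close>

lemma orthonormal_mat_mult:
  assumes U: "orthonormal_mat n U" and V: "orthonormal_mat n V"
  shows "orthonormal_mat n (U * V)"
proof -
  note u = U[unfolded orthonormal_mat_def] and v = V[unfolded orthonormal_mat_def]
  then have c: "U \<in> carrier_mat n n" "V \<in> carrier_mat n n"
    "transpose_mat U \<in> carrier_mat n n" "transpose_mat V \<in> carrier_mat n n" by auto
  have "transpose_mat V * transpose_mat U * (U * V) = transpose_mat V * (transpose_mat U * U) * V"
    using c by (simp add: assoc_mult_mat[of _ n n _ n _ n])
  moreover have "U * V * (transpose_mat V * transpose_mat U) = U * (V * transpose_mat V) * transpose_mat U"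
    using c by (simp add: assoc_mult_mat[of _ n n _ n _ n])
  ultimately show ?thesis using u v c by (simp add: orthonormal_mat_def transpose_mult[of _ n n _ n])
qed

lemma orthonormal_mat_transpose: "orthonormal_mat n U \<Longrightarrow> orthonormal_mat n (transpose_mat U)"
  by (auto simp: orthonormal_mat_def)

lemma orthonormal_mat_cancel:
  assumes "orthonormal_mat m U" "orthonormal_mat n V" "A \<in> carrier_mat m n"
  shows "U * (transpose_mat U * A * V) * transpose_mat V = A"
proof -
  have c: "U \<in> carrier_mat m m" "transpose_mat U \<in> carrier_mat m m"
    "V \<in> carrier_mat n n" "transpose_mat V \<in> carrier_mat n n"
    using assms by (auto simp: orthonormal_mat_def)
  have "U * (transpose_mat U * A * V) * transpose_mat V = (U * transpose_mat U) * A * (V * transpose_mat V)"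
    using c assms(3)
    by (simp add: assoc_mult_mat[of _ m m _ m _ n] assoc_mult_mat[of _ m m _ n _ n] assoc_mult_mat[of _ m n _ n _ n])
  then show ?thesis using assms by (simp add: orthonormal_mat_def)
qed

lemma orthonormal_mat_cancel':
  assumes "orthonormal_mat m U" "orthonormal_mat n V" "A \<in> carrier_mat m n"
  shows "transpose_mat U * (U * A * transpose_mat V) * V = A"
  using orthonormal_mat_cancel[OF orthonormal_mat_transpose[OF assms(1)] orthonormal_mat_transpose[OF assms(2)] assms(3)]
  by simp

lemma orthonormal_mat_char_poly:
  assumes V: "orthonormal_mat n V" and A: "A \<in> carrier_mat n n"
  shows "char_poly (V * A * transpose_mat V) = char_poly A"
proof (rule char_poly_similar, rule similar_matI)
  show "{V * A * transpose_mat V, A, V, transpose_mat V} \<subseteq> carrier_mat n n"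
    using V A by (auto simp: orthonormal_mat_def)
qed (use V in \<open>auto simp: orthonormal_mat_def\<close>)

text \<open>The Hermitian form \<open>q\<close> of the eigenvector equals its own conjugate by
  symmetry of the real matrix. It is also c times the squared norm \<open>N\<close>, which is
  nonzero, so c is real.\<close>

lemma symmetric_complex_eigenvalue_real:
  fixes A :: "real mat"
  assumes A: "A \<in> carrier_mat n n" and sym: "transpose_mat A = A"
    and ev: "eigenvector (map_mat complex_of_real A) z c"
  shows "c \<in> \<real>"
proof -
  have z: "z \<in> carrier_vec n" and z0: "z \<noteq> 0\<^sub>v n"
    and Az: "map_mat complex_of_real A *\<^sub>v z = c \<cdot>\<^sub>v z"
    using ev A by (auto simp: eigenvector_def)
  have eq: "(\<Sum>j<n. of_real (A $$ (i, j)) * z $ j) = c * z $ i" if "i < n" for i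
    using arg_cong[OF Az, of "\<lambda>v. v $ i"] that A z
    by (simp add: scalar_prod_def atLeast0LessThan)
  have symA: "A $$ (i, j) = A $$ (j, i)" if "i < n" "j < n" for i j
    using arg_cong[OF sym, of "\<lambda>B. B $$ (j, i)"] that A by simp
  define q where "q = (\<Sum>i<n. \<Sum>j<n. of_real (A $$ (i, j)) * z $ j * cnj (z $ i))"
  define N where "N = (\<Sum>i<n. (cmod (z $ i))\<^sup>2)"
  have "q = (\<Sum>i<n. (\<Sum>j<n. of_real (A $$ (i, j)) * z $ j) * cnj (z $ i))"
    by (simp add: q_def sum_distrib_right)
  also have "\<dots> = (\<Sum>i<n. c * of_real ((cmod (z $ i))\<^sup>2))"
    by (intro sum.cong refl) (auto simp: eq complex_norm_square mult.assoc simp del: of_real_power)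
  finally have q: "q = c * of_real N" by (simp add: N_def sum_distrib_left)
  have "cnj q = (\<Sum>j<n. \<Sum>i<n. of_real (A $$ (i, j)) * cnj (z $ j) * z $ i)"
    unfolding q_def by (subst sum.swap) simp
  also have "\<dots> = q"
    unfolding q_def by (intro sum.cong refl) (auto simp: symA)
  finally have "cnj q = q" .
  have "N \<noteq> 0"
  proof
    assume "N = 0"
    then have "\<forall>i<n. z $ i = 0" by (simp add: N_def sum_nonneg_eq_0_iff)
    then have "z = 0\<^sub>v n" using z by (intro eq_vecI) auto
    with z0 show False by simp
  qed
  then have "cnj c = c" using \<open>cnj q = q\<close> q by simp
  then show ?thesis by (simp add: Reals_cnj_iff)
qed

text \<open>Over the complex numbers the polynomial splits, and all its roots are real. The
  factorization descends to the reals because the embedding of polynomials is injective.\<close>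

lemma symmetric_char_poly_splits:
  fixes A :: "real mat"
  assumes A: "A \<in> carrier_mat n n" and sym: "transpose_mat A = A"
  shows "\<exists>es. char_poly A = (\<Prod>e\<leftarrow>es. [:- e, 1:])"
proof -
  interpret h: map_poly_inj_idom_hom complex_of_real ..
  let ?B = "map_mat complex_of_real A"
  have B: "?B \<in> carrier_mat n n" using A by simp
  obtain cs where cs: "char_poly ?B = (\<Prod>c\<leftarrow>cs. [:- c, 1:])"
    using char_poly_factorized[OF B] by blast
  have "c \<in> \<real>" if "c \<in> set cs" for c
  proof -
    have "poly (char_poly ?B) c = 0" unfolding cs using that by (auto simp: poly_prod_list prod_list_zero_iff)
    then have "eigenvalue ?B c" using eigenvalue_root_char_poly[OF B] by simp
    then show ?thesis using symmetric_complex_eigenvalue_real[OF A sym] by (auto simp: eigenvalue_def)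
  qed
  then have cs': "cs = map complex_of_real (map Re cs)"
    by (auto intro!: map_idI[symmetric] simp: of_real_Re)
  have "map_poly complex_of_real (char_poly A) = char_poly ?B"
    by (rule of_real_hom.char_poly_hom[OF A, symmetric])
  also have "\<dots> = (\<Prod>r\<leftarrow>map Re cs. [:- complex_of_real r, 1:])"
    unfolding cs by (subst cs') (simp only: map_map o_def)
  also have "\<dots> = map_poly complex_of_real (\<Prod>r\<leftarrow>map Re cs. [:- r, 1:])"
    by (simp add: h.hom_prod_list o_def)
  finally have "char_poly A = (\<Prod>r\<leftarrow>map Re cs. [:- r, 1:])"
    by (rule h.injectivity)
  then show ?thesis by blast
qed

text \<open>
  The Householder reflection exchanging \<open>v\<close> and the first unit vector. For \<open>v $ 0 = 1\<close> the
  division by 0 yields the identity matrix, as it should.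
\<close>

lemma orthonormal_mat_with_first_col:
  fixes v :: "real vec"
  assumes v: "v \<in> carrier_vec n" and unit: "scalar_prod v v = 1" and n: "0 < n"
  shows "\<exists>H. orthonormal_mat n H \<and> col H 0 = v"
proof -
  define w where "w i = v $ i - (if i = 0 then 1 else 0)" for i
  define \<kappa> where "\<kappa> = 1 / (1 - v $ 0)"
  define H where "H = mat n n (\<lambda>(i, j). (if i = j then 1 else 0) - \<kappa> * w i * w j)"
  have H: "H \<in> carrier_mat n n" by (simp add: H_def)
  have vv: "(\<Sum>i<n. (v $ i)\<^sup>2) = 1"
    using unit v by (simp add: scalar_prod_def power2_eq_square atLeast0LessThan)
  have "(\<Sum>i<n. w i * w i) = (\<Sum>i<n. (v $ i)\<^sup>2 - 2 * (if i = 0 then v $ i else 0) + (if i = 0 then 1 else 0))"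
    by (intro sum.cong) (auto simp: w_def power2_eq_square algebra_simps)
  also have "\<dots> = 2 * (1 - v $ 0)"
    using n by (simp add: sum.distrib sum_subtractf vv flip: sum_distrib_left)
  finally have ww: "(\<Sum>i<n. w i * w i) = 2 * (1 - v $ 0)" .
  \<comment> \<open>Away from \<open>v $ 0 = 1\<close> this says that \<open>\<kappa>\<close> is 2
    over the squared length of \<open>w\<close>. In this multiplied form it also covers the
    degenerate case, where both sides are 0.\<close>
  have \<kappa>: "\<kappa> * (\<kappa> * (\<Sum>i<n. w i * w i)) = 2 * \<kappa>"
    unfolding ww \<kappa>_def by (cases "v $ 0 = 1") (simp_all add: divide_simps)
  have sym: "transpose_mat H = H" by (rule eq_matI) (auto simp: H_def)
  have "H * H = 1\<^sub>m n"
  proof (rule eq_matI)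
    fix i j assume "i < dim_row (1\<^sub>m n)" "j < dim_col (1\<^sub>m n)"
    then have i: "i < n" and j: "j < n" by auto
    have "(H * H) $$ (i, j) = (\<Sum>l<n. H $$ (i, l) * H $$ (l, j))"
      using i j H by (simp add: scalar_prod_def atLeast0LessThan)
    also have "\<dots> = (\<Sum>l<n. (if l = i then (if i = j then 1 else 0) - \<kappa> * w l * w j else 0)
        - (if l = j then \<kappa> * w i * w l else 0) + w i * w j * (\<kappa> * (\<kappa> * (w l * w l))))"
      using i j by (intro sum.cong) (auto simp: H_def algebra_simps)
    also have "\<dots> = (if i = j then 1 else 0) - 2 * \<kappa> * w i * w j
        + w i * w j * (\<kappa> * (\<kappa> * (\<Sum>l<n. w l * w l)))"
      using i j by (simp add: sum.distrib sum_subtractf flip: sum_distrib_left)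
    also have "\<dots> = (1\<^sub>m n :: real mat) $$ (i, j)" unfolding \<kappa> using i j by simp
    finally show "(H * H) $$ (i, j) = (1\<^sub>m n :: real mat) $$ (i, j)" .
  qed (use H in auto)
  then have "orthonormal_mat n H" using H sym by (simp add: orthonormal_mat_def)
  moreover have "col H 0 = v"
  proof (rule eq_vecI)
    fix i assume "i < dim_vec v"
    then have i: "i < n" using v by simp
    show "col H 0 $ i = v $ i"
    proof (cases "v $ 0 = 1")
      case True
      have "(\<Sum>i<n. w i * w i) = 0" using ww True by simp
      then have "w i = 0" using i by (simp add: sum_nonneg_eq_0_iff)
      then show ?thesis using i n by (simp add: H_def w_def)
    next
      case False
      then have "\<kappa> * w i * w 0 = - w i" by (simp add: \<kappa>_def w_def[of 0] field_simps)
      then show ?thesis using i n by (simp add: H_def) (simp add: w_def)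
    qed
  qed (use v H in auto)
  ultimately show ?thesis by blast
qed

section \<open>Splitting off eigenvalues of a symmetric matrix one at a time\<close>

lemma real_unit_eigenvector:
  fixes A :: "real mat"
  assumes A: "A \<in> carrier_mat n n" and e: "eigenvalue A e"
  shows "\<exists>v. v \<in> carrier_vec n \<and> scalar_prod v v = 1 \<and> A *\<^sub>v v = e \<cdot>\<^sub>v v"
proof -
  obtain u where u: "u \<in> carrier_vec n" "u \<noteq> 0\<^sub>v n" "A *\<^sub>v u = e \<cdot>\<^sub>v u"
    using e A by (auto simp: eigenvalue_def eigenvector_def)
  have pos: "0 < scalar_prod u u" using conjugate_square_greater_0_vec[OF u(1)] u(2) by simp
  define v where "v = (1 / sqrt (scalar_prod u u)) \<cdot>\<^sub>v u"
  have "scalar_prod v v = 1" using pos u(1) by (simp add: v_def)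
  moreover have "A *\<^sub>v v = e \<cdot>\<^sub>v v"
    using A u by (simp add: v_def mult_mat_vec smult_smult_assoc mult.commute)
  moreover have "v \<in> carrier_vec n" using u(1) by (simp add: v_def)
  ultimately show ?thesis by blast
qed

text \<open>In an orthonormal basis that starts with a unit eigenvector, the first column of the
  matrix is \<open>e\<close> times the first unit vector. Symmetry clears the first row as well, and
  the remaining block \<open>B\<close> is again symmetric.\<close>

lemma symmetric_deflation:
  fixes A :: "real mat"
  assumes A: "A \<in> carrier_mat (Suc l) (Suc l)" and sym: "transpose_mat A = A" and e: "eigenvalue A e"
  shows "\<exists>H B. orthonormal_mat (Suc l) H \<and> B \<in> carrier_mat l l \<and> transpose_mat B = B \<and>
    A = H * four_block_mat (mat_diag 1 (\<lambda>_. e)) (0\<^sub>m 1 l) (0\<^sub>m l 1) B * transpose_mat H"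
proof -
  let ?n = "Suc l"
  obtain v where v: "v \<in> carrier_vec ?n" "scalar_prod v v = 1" "A *\<^sub>v v = e \<cdot>\<^sub>v v"
    using real_unit_eigenvector[OF A e] by blast
  obtain H where orth: "orthonormal_mat ?n H" and H0: "col H 0 = v"
    using orthonormal_mat_with_first_col[OF v(1,2)] by blast
  have H: "H \<in> carrier_mat ?n ?n" "transpose_mat H \<in> carrier_mat ?n ?n" and HH: "transpose_mat H * H = 1\<^sub>m ?n"
    using orth by (auto simp: orthonormal_mat_def)
  define A1 where "A1 = transpose_mat H * A * H"
  have A1: "A1 \<in> carrier_mat ?n ?n" using A H by (simp add: A1_def)
  have "transpose_mat A1 = A1"
    unfolding A1_def using A H sym
    by (simp add: transpose_mult[of _ ?n ?n _ ?n] assoc_mult_mat[of _ ?n ?n _ ?n _ ?n])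
  then have symA1: "A1 $$ (i, j) = A1 $$ (j, i)" if "i < ?n" "j < ?n" for i j
    using arg_cong[of _ _ "\<lambda>B. B $$ (j, i)"] that A1 by (metis carrier_matD index_transpose_mat(1))
  \<comment> \<open>The first column of \<open>H\<close> is \<open>v\<close>, so \<open>A\<close>
    acts on it as \<open>e\<close>; what remains is a column of the identity.\<close>
  have col_A1: "col A1 0 = e \<cdot>\<^sub>v col (transpose_mat H * H) 0"
  proof -
    have "col A1 0 = transpose_mat H *\<^sub>v (A *\<^sub>v v)"
      unfolding A1_def
      by (subst col_mult2[of _ ?n ?n _ ?n]; (unfold H0)?; (rule assoc_mult_mat_vec[of _ ?n ?n _ ?n])?)
        (use A H v(1) in auto)
    also have "\<dots> = e \<cdot>\<^sub>v col (transpose_mat H * H) 0"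
      unfolding v(3) by (subst col_mult2[of _ ?n ?n _ ?n]; (unfold H0)?; (rule mult_mat_vec[of _ ?n ?n])?)
        (use H v(1) in auto)
    finally show ?thesis .
  qed
  have col0: "A1 $$ (i, 0) = (if i = 0 then e else 0)" if "i < ?n" for i
  proof -
    have "A1 $$ (i, 0) = vec_index (col A1 0) i" using that A1 by simp
    also have "\<dots> = (if i = 0 then e else 0)" unfolding col_A1 HH using that by simp
    finally show ?thesis .
  qed
  define B where "B = mat l l (\<lambda>(i, j). A1 $$ (Suc i, Suc j))"
  have B: "B \<in> carrier_mat l l" by (simp add: B_def)
  have symB: "transpose_mat B = B" by (rule eq_matI) (auto simp: B_def symA1)
  have blk: "A1 = four_block_mat (mat_diag 1 (\<lambda>_. e)) (0\<^sub>m 1 l) (0\<^sub>m l 1) B"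
  proof (rule eq_matI)
    fix i j
    assume "i < dim_row (four_block_mat (mat_diag 1 (\<lambda>_. e)) (0\<^sub>m 1 l) (0\<^sub>m l 1) B)"
      and "j < dim_col (four_block_mat (mat_diag 1 (\<lambda>_. e)) (0\<^sub>m 1 l) (0\<^sub>m l 1) B)"
    then have "i < ?n" "j < ?n" by (auto simp: B_def mat_diag_def)
    then show "A1 $$ (i, j) = four_block_mat (mat_diag 1 (\<lambda>_. e)) (0\<^sub>m 1 l) (0\<^sub>m l 1) B $$ (i, j)"
      using col0[of i] col0[of j] symA1[of 0 j]
      by (cases i; cases j) (auto simp: B_def mat_diag_def)
  qed (use A1 in \<open>auto simp: B_def mat_diag_def\<close>)
  have "A = H * A1 * transpose_mat H"
    unfolding A1_def by (rule orthonormal_mat_cancel[OF orth orth A, symmetric])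
  with orth B symB show ?thesis unfolding blk by blast
qed

text \<open>Induction on the list of roots, each step deflating by its head. The eigenvalues appear
  on the diagonal in the order of \<open>es\<close>, which leaves the choice of order to the user of
  the result.\<close>

theorem symmetric_orthonormal_diagonalization:
  fixes A :: "real mat"
  assumes "A \<in> carrier_mat n n" and "transpose_mat A = A"
    and "char_poly A = (\<Prod>e\<leftarrow>es. [:- e, 1:])"
  shows "\<exists>V. orthonormal_mat n V \<and> A = V * mat_diag n (\<lambda>i. es ! i) * transpose_mat V"
  using assms
proof (induction es arbitrary: n A)
  case Nil
  then have "n = 0" using degree_monic_char_poly[of A n] by simp
  then show ?case using Nil.prems(1)
    by (intro exI[of _ "1\<^sub>m 0"]) (auto simp: orthonormal_mat_def mat_diag_def intro!: eq_matI)
next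
  case (Cons e es)
  note A = Cons.prems(1) and sym = Cons.prems(2) and cp = Cons.prems(3)
  define l where "l = length es"
  have n: "n = Suc l"
    using degree_monic_char_poly[OF A] degree_linear_factors[of uminus "e # es"] cp by (simp add: l_def)
  have "eigenvalue A e" using eigenvalue_root_char_poly[OF A] cp by simp
  then obtain H B where H: "orthonormal_mat n H" and B: "B \<in> carrier_mat l l" and symB: "transpose_mat B = B"
    and AH: "A = H * four_block_mat (mat_diag 1 (\<lambda>_. e)) (0\<^sub>m 1 l) (0\<^sub>m l 1) B * transpose_mat H"
    using symmetric_deflation[of A l e] A sym unfolding n by blast
  let ?A1 = "four_block_mat (mat_diag 1 (\<lambda>_. e)) (0\<^sub>m 1 l) (0\<^sub>m l 1) B"
  have A1: "?A1 \<in> carrier_mat n n" using B n 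
    using four_block_carrier_mat[of "mat_diag 1 (\<lambda>_. e)" 1 1 B l l] by simp
  have "char_poly A = char_poly ?A1"
    unfolding AH by (rule orthonormal_mat_char_poly[OF H A1])
  also have "\<dots> = char_poly (mat_diag 1 (\<lambda>_. e)) * char_poly B"
    by (rule char_poly_four_block_zeros_col[OF _ _ B]) auto
  also have "char_poly (mat_diag 1 (\<lambda>_. e)) = [:- e, 1:]"
    by (subst char_poly_upper_triangular[of _ 1]) (auto simp: mat_diag_def diag_mat_def)
  \<comment> \<open>Cancelling the common linear factor gives the factorization of
    \<open>char_poly B\<close> that the induction hypothesis asks for.\<close>
  finally have "[:- e, 1:] * char_poly B = [:- e, 1:] * (\<Prod>e\<leftarrow>es. [:- e, 1:])"
    using cp by (simp del: mult_pCons_left)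
  then have "char_poly B = (\<Prod>e\<leftarrow>es. [:- e, 1:])"
    by (simp del: mult_pCons_left)
  from Cons.IH[OF B symB this] obtain V where V: "orthonormal_mat l V"
    and BV: "B = V * mat_diag l (\<lambda>i. es ! i) * transpose_mat V" by blast
  have Vc: "V \<in> carrier_mat l l" "transpose_mat V \<in> carrier_mat l l"
    and VV: "transpose_mat V * V = 1\<^sub>m l" "V * transpose_mat V = 1\<^sub>m l"
    using V by (auto simp: orthonormal_mat_def)
  \<comment> \<open>\<open>V\<close> bordered by 1 leaves the coordinate already split off
    untouched, so \<open>H * W\<close> diagonalizes \<open>A\<close>.\<close>
  define W where "W = four_block_mat (1\<^sub>m 1) (0\<^sub>m 1 l) (0\<^sub>m l 1) V"
  have Wt: "transpose_mat W = four_block_mat (1\<^sub>m 1) (0\<^sub>m 1 l) (0\<^sub>m l 1) (transpose_mat V)"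
    unfolding W_def using Vc by (subst transpose_four_block_mat[of _ 1 1 _ l _ l]) auto
  note mult = mult_four_block_mat[of _ 1 1 _ l _ l _ _ 1 _ l]
  have W: "orthonormal_mat n W"
    unfolding orthonormal_mat_def Wt unfolding W_def using Vc VV
    by (auto simp: mult n)
  have D: "mat_diag n (\<lambda>i. (e # es) ! i) =
      four_block_mat (mat_diag 1 (\<lambda>_. e)) (0\<^sub>m 1 l) (0\<^sub>m l 1) (mat_diag l (\<lambda>i. es ! i))"
    by (rule eq_matI) (auto simp: mat_diag_def n nth_Cons')
  have "?A1 = W * mat_diag n (\<lambda>i. (e # es) ! i) * transpose_mat W"
    unfolding D Wt unfolding W_def BV using Vc
    by (simp add: mult mat_diag_def mult_carrier_mat[of _ l l _ l])
  then have "A = H * (W * mat_diag n (\<lambda>i. (e # es) ! i) * transpose_mat W) * transpose_mat H"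
    using AH by simp
  also have "\<dots> = (H * W) * mat_diag n (\<lambda>i. (e # es) ! i) * transpose_mat (H * W)"
    using H W by (simp add: orthonormal_mat_def transpose_mult[of _ n n _ n] assoc_mult_mat[of _ n n _ n _ n]
        mult_carrier_mat[of _ n n _ n])
  finally show ?case using orthonormal_mat_mult[OF H W] by blast
qed

section \<open>Singular values\<close>

lemma proots_linear_factors: "proots (\<Prod>e\<leftarrow>es. [:- e, 1:]) = mset (es :: real list)"
proof (induction es)
  case (Cons e es)
  have "proots ([:- e, 1:] * (\<Prod>e\<leftarrow>es. [:- e, 1:])) = proots [:- e, 1:] + proots (\<Prod>e\<leftarrow>es. [:- e, 1:])"
    by (rule proots_mult) (auto simp: prod_list_zero_iff)
  then show ?case using Cons by (simp del: mult_pCons_left)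
qed simp

lemma char_poly_mat_diag: "char_poly (mat_diag n f) = (\<Prod>j\<leftarrow>[0..<n]. [:- f j, 1:])"
proof -
  have "diag_mat (mat_diag n f) = map f [0..<n]" by (auto simp: diag_mat_def mat_diag_def)
  then show ?thesis
    by (subst char_poly_upper_triangular[of _ n]) (auto simp: mat_diag_def o_def)
qed

text \<open>The characteristic polynomial fixes the multiset of eigenvalues, so any nonnegative
  nonincreasing \<open>t\<close> whose squares are these eigenvalues must be the list of singular
  values before truncation.\<close>

lemma singular_value_eqI:
  assumes X: "X \<in> carrier_mat m n"
    and cp: "char_poly (transpose_mat X * X) = (\<Prod>j\<leftarrow>[0..<n]. [:- (t j)\<^sup>2, 1:])"
    and t: "\<And>i. i < n \<Longrightarrow> 0 \<le> t i" "\<And>i j. i \<le> j \<Longrightarrow> j < n \<Longrightarrow> t j \<le> t i"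
    and i: "i < min m n"
  shows "singular_value i X = t i"
proof -
  have "char_poly (transpose_mat X * X) = (\<Prod>e\<leftarrow>map (\<lambda>j. (t j)\<^sup>2) [0..<n]. [:- e, 1:])"
    unfolding cp by (simp add: o_def)
  then have "image_mset sqrt (proots (char_poly (transpose_mat X * X))) = mset (map (\<lambda>j. sqrt ((t j)\<^sup>2)) [0..<n])"
    by (simp only: proots_linear_factors mset_map image_mset.compositionality o_def)
  also have "map (\<lambda>j. sqrt ((t j)\<^sup>2)) [0..<n] = map t [0..<n]"
    using t(1) by simp
  also have "mset (map t [0..<n]) = mset (rev (map t [0..<n]))" by (rule mset_rev[symmetric])
  finally have "sorted_list_of_multiset (image_mset sqrt (proots (char_poly (transpose_mat X * X))))
      = sort (rev (map t [0..<n]))"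
    by (simp only: sorted_list_of_multiset_mset)
  \<comment> \<open>As \<open>t\<close> is nonincreasing, the reversed list is already sorted
    upwards; the \<open>rev\<close> in \<open>singular_values\<close> restores the order of
    \<open>t\<close>.\<close>
  also have "\<dots> = rev (map t [0..<n])"
    using t(2) by (intro sorted_sort_id) (auto simp: sorted_iff_nth_mono rev_nth)
  finally have "singular_values X = take (min m n) (map t [0..<n])"
    using X by (simp add: singular_values_def)
  then show ?thesis using i by (simp add: singular_value_def)
qed

section \<open>Gram matrices and their diagonalization\<close>

lemma gram_mult_right:
  fixes X W :: "real mat"
  assumes X: "X \<in> carrier_mat m n" and W: "W \<in> carrier_mat n n"
  shows "transpose_mat (X * W) * (X * W) = transpose_mat W * (transpose_mat X * X) * W"
proof -
  have "transpose_mat (X * W) * (X * W) = transpose_mat W * (transpose_mat X * (X * W))"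
    using X W by (simp add: transpose_mult[of _ m n _ n] assoc_mult_mat[of _ n n _ m _ n])
  also have "transpose_mat X * (X * W) = (transpose_mat X * X) * W"
    using X W by (simp add: assoc_mult_mat[of _ n m _ n _ n])
  also have "transpose_mat W * ((transpose_mat X * X) * W) = transpose_mat W * (transpose_mat X * X) * W"
    using X W by (intro assoc_mult_mat[of _ n n _ n _ n, symmetric]) auto
  finally show ?thesis .
qed

lemma gram_orthonormal_left:
  assumes U: "orthonormal_mat m U" and X: "X \<in> carrier_mat m n"
  shows "transpose_mat (U * X) * (U * X) = transpose_mat X * X"
proof -
  have Uc: "U \<in> carrier_mat m m" "transpose_mat U \<in> carrier_mat m m" and UU: "transpose_mat U * U = 1\<^sub>m m"
    using U by (auto simp: orthonormal_mat_def)
  have "transpose_mat (U * X) * (U * X) = transpose_mat X * (transpose_mat U * (U * X))"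
    using X Uc by (simp add: transpose_mult[of _ m m _ n] assoc_mult_mat[of _ n m _ m _ n])
  also have "transpose_mat U * (U * X) = (transpose_mat U * U) * X"
    using X Uc by (simp add: assoc_mult_mat[of _ m m _ m _ n])
  finally show ?thesis using X by (simp add: UU)
qed

lemma gram_entries_diagonal:
  fixes X V :: "real mat"
  assumes X: "X \<in> carrier_mat m n" and V: "orthonormal_mat n V"
    and eq: "transpose_mat X * X = V * mat_diag n e * transpose_mat V"
    and j: "j < n" and l: "l < n"
  shows "(\<Sum>i<m. (X * V) $$ (i, j) * (X * V) $$ (i, l)) = (if j = l then e j else 0)"
proof -
  have Vc: "V \<in> carrier_mat n n" "transpose_mat V \<in> carrier_mat n n" using V by (auto simp: orthonormal_mat_def)
  have "transpose_mat (X * V) * (X * V) = transpose_mat V * (transpose_mat X * X) * V"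
    by (rule gram_mult_right[OF X Vc(1)])
  also have "\<dots> = mat_diag n e"
    unfolding eq by (rule orthonormal_mat_cancel'[OF V V]) simp
  finally have "(transpose_mat (X * V) * (X * V)) $$ (j, l) = mat_diag n e $$ (j, l)" by simp
  moreover have "(transpose_mat (X * V) * (X * V)) $$ (j, l) = (\<Sum>i<m. (X * V) $$ (i, j) * (X * V) $$ (i, l))"
    using j l X Vc by (simp add: scalar_prod_def atLeast0LessThan)
  ultimately show "(\<Sum>i<m. (X * V) $$ (i, j) * (X * V) $$ (i, l)) = (if j = l then e j else 0)"
    using j l by (auto simp: mat_diag_def)
qed

text \<open>This is the part of a singular value decomposition that the later estimates use:
  \<open>V\<close> holds right singular vectors, and the columns of \<open>X * V\<close> are
  orthogonal with lengths \<open>t j\<close>. Left singular vectors are not constructed;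
  \<open>t\<close> runs over all n columns.\<close>

lemma gram_matrix_diagonalization:
  fixes X :: "real mat"
  assumes X: "X \<in> carrier_mat m n"
  obtains V t where "orthonormal_mat n V"
    and "\<And>j l. j < n \<Longrightarrow> l < n \<Longrightarrow>
      (\<Sum>i<m. (X * V) $$ (i, j) * (X * V) $$ (i, l)) = (if j = l then (t j)\<^sup>2 else 0)"
    and "\<And>i. i < n \<Longrightarrow> 0 \<le> t i" and "\<And>i j. i \<le> j \<Longrightarrow> j < n \<Longrightarrow> t j \<le> t i"
    and "\<And>i. i < min m n \<Longrightarrow> singular_value i X = t i"
proof -
  let ?G = "transpose_mat X * X"
  have G: "?G \<in> carrier_mat n n" using X by simp
  have sym: "transpose_mat ?G = ?G" using X by (simp add: transpose_mult[of _ n m _ n])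
  obtain fs where fs: "char_poly ?G = (\<Prod>e\<leftarrow>fs. [:- e, 1:])"
    using symmetric_char_poly_splits[OF G sym] by blast
  \<comment> \<open>The product of linear factors ignores the order of the roots, so they may be
    arranged to be nonincreasing, matching \<open>singular_values\<close>.\<close>
  define es where "es = rev (sort fs)"
  have "(\<Prod>e\<leftarrow>es. [:- e, 1:]) = (\<Prod>e\<in>#mset es. [:- e, 1:])"
    by (metis mset_map prod_mset_prod_list)
  also have "\<dots> = (\<Prod>e\<leftarrow>fs. [:- e, 1:])"
    unfolding es_def mset_rev mset_sort by (metis mset_map prod_mset_prod_list)
  finally have es: "char_poly ?G = (\<Prod>e\<leftarrow>es. [:- e, 1:])" using fs by simp
  have len: "length es = n"
    using degree_monic_char_poly[OF G] degree_linear_factors[of uminus es] es by simp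
  obtain V where V: "orthonormal_mat n V" and eq: "?G = V * mat_diag n (\<lambda>i. es ! i) * transpose_mat V"
    using symmetric_orthonormal_diagonalization[OF G sym es] by blast
  note gram = gram_entries_diagonal[OF X V eq]
  \<comment> \<open>Each eigenvalue is the squared length of a column of
    \<open>X * V\<close>.\<close>
  have nonneg: "0 \<le> es ! j" if "j < n" for j
    using gram[OF that that] sum_nonneg[of "{..<m}" "\<lambda>i. (X * V) $$ (i, j) * (X * V) $$ (i, j)"] by simp
  have anti: "es ! j \<le> es ! i" if "i \<le> j" "j < n" for i j
    using sorted_wrt_iff_nth_less[of "(\<lambda>x y. y \<le> x)" es] that len unfolding es_def
    by (cases "i = j") (auto simp: sorted_wrt_rev)
  define t where "t j = sqrt (es ! j)" for j
  have tt: "(t j)\<^sup>2 = es ! j" if "j < n" for j using nonneg[OF that] by (simp add: t_def)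
  have t0: "0 \<le> t i" if "i < n" for i using nonneg[OF that] by (simp add: t_def)
  have tanti: "t j \<le> t i" if "i \<le> j" "j < n" for i j using anti[OF that] by (simp add: t_def)
  have "es = map (\<lambda>j. (t j)\<^sup>2) [0..<n]"
    by (rule nth_equalityI) (simp_all add: len tt)
  then have "char_poly ?G = (\<Prod>j\<leftarrow>[0..<n]. [:- (t j)\<^sup>2, 1:])" using es by (simp add: o_def)
  note sv = singular_value_eqI[OF X this t0 tanti]
  show thesis
    by (rule that[OF V _ t0 tanti sv]) (simp_all add: gram tt)
qed

section \<open>Orthogonal invariance of the Frobenius norm and the singular values\<close>

lemma frobenius_norm_sq:
  "X \<in> carrier_mat m n \<Longrightarrow> (frobenius_norm X)\<^sup>2 = (\<Sum>i<m. \<Sum>j<n. (X $$ (i, j))\<^sup>2)"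
  by (auto simp: frobenius_norm_def intro!: real_sqrt_pow2 sum_nonneg)

lemma frobenius_norm_transpose: "frobenius_norm (transpose_mat X) = frobenius_norm X"
proof -
  have "(\<Sum>i<dim_col X. \<Sum>j<dim_row X. (transpose_mat X $$ (i, j))\<^sup>2) = (\<Sum>i<dim_col X. \<Sum>j<dim_row X. (X $$ (j, i))\<^sup>2)"
    by (intro sum.cong) auto
  then show ?thesis unfolding frobenius_norm_def by (subst (2) sum.swap) simp
qed

text \<open>The squared norm is the trace of the Gram matrix, which a left orthogonal factor does
  not change.\<close>

lemma frobenius_norm_orthonormal_left:
  assumes U: "orthonormal_mat m U" and X: "X \<in> carrier_mat m n"
  shows "frobenius_norm (U * X) = frobenius_norm X"
proof -
  have Uc: "U \<in> carrier_mat m m" "transpose_mat U \<in> carrier_mat m m" using U by (auto simp: orthonormal_mat_def)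
  have trace: "(frobenius_norm Z)\<^sup>2 = (\<Sum>j<n. (transpose_mat Z * Z) $$ (j, j))" if "Z \<in> carrier_mat m n" for Z
    using that unfolding frobenius_norm_sq[OF that]
    by (subst sum.swap) (auto simp: scalar_prod_def atLeast0LessThan power2_eq_square intro!: sum.cong)
  have "(frobenius_norm (U * X))\<^sup>2 = (frobenius_norm X)\<^sup>2"
    using X Uc gram_orthonormal_left[OF U X] by (simp only: trace mult_carrier_mat)
  then show ?thesis by (simp add: frobenius_norm_def sum_nonneg)
qed

text \<open>Transposition preserves the norm and turns the right factor into a left one.\<close>

lemma frobenius_norm_orthonormal:
  assumes U: "orthonormal_mat m U" and V: "orthonormal_mat n V" and X: "X \<in> carrier_mat m n"
  shows "frobenius_norm (U * X * transpose_mat V) = frobenius_norm X"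
proof -
  have c: "U * X \<in> carrier_mat m n" "V \<in> carrier_mat n n" using U V X by (auto simp: orthonormal_mat_def)
  have "transpose_mat (U * X * transpose_mat V) = V * transpose_mat (U * X)"
    using c by (simp add: transpose_mult[of _ m n _ n])
  then have "frobenius_norm (U * X * transpose_mat V) = frobenius_norm (V * transpose_mat (U * X))"
    using frobenius_norm_transpose[of "U * X * transpose_mat V"] by simp
  also have "\<dots> = frobenius_norm (U * X)"
    using c by (subst frobenius_norm_orthonormal_left[OF V]) (auto simp: frobenius_norm_transpose)
  also have "\<dots> = frobenius_norm X" by (rule frobenius_norm_orthonormal_left[OF U X])
  finally show ?thesis .
qed

text \<open>The left factor drops out of the Gram matrix and the right one conjugates it, so its
  characteristic polynomial is unchanged.\<close>

lemma singular_value_orthonormal: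
  assumes U: "orthonormal_mat m U" and V: "orthonormal_mat n V" and X: "X \<in> carrier_mat m n"
  shows "singular_value i (U * X * transpose_mat V) = singular_value i X"
proof -
  have c: "U \<in> carrier_mat m m" "transpose_mat U \<in> carrier_mat m m" "V \<in> carrier_mat n n" "transpose_mat V \<in> carrier_mat n n"
    using U V by (auto simp: orthonormal_mat_def)
  have UX: "U * X \<in> carrier_mat m n" using c X by simp
  have "transpose_mat (U * X * transpose_mat V) * (U * X * transpose_mat V)
      = V * (transpose_mat X * X) * transpose_mat V"
    using gram_mult_right[OF UX c(4)] gram_orthonormal_left[OF U X] by simp
  then have "char_poly (transpose_mat (U * X * transpose_mat V) * (U * X * transpose_mat V))
      = char_poly (transpose_mat X * X)"
    using orthonormal_mat_char_poly[OF V, of "transpose_mat X * X"] X by simp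
  then show ?thesis using c X by (simp add: singular_value_def singular_values_def)
qed

text \<open>The squares of all \<open>t j\<close> are the squared column lengths of
  \<open>X * V\<close> and add up to the squared norm of \<open>X\<close>; the left side keeps only
  the first \<open>min m n\<close> of them.\<close>

lemma sum_singular_values_sq_le:
  assumes X: "X \<in> carrier_mat m n"
  shows "(\<Sum>i<min m n. (singular_value i X)\<^sup>2) \<le> (frobenius_norm X)\<^sup>2"
proof -
  obtain V t where V: "orthonormal_mat n V"
    and gram: "\<And>j l. j < n \<Longrightarrow> l < n \<Longrightarrow>
      (\<Sum>i<m. (X * V) $$ (i, j) * (X * V) $$ (i, l)) = (if j = l then (t j)\<^sup>2 else 0)"
    and t: "\<And>i. i < n \<Longrightarrow> 0 \<le> t i" "\<And>i j. i \<le> j \<Longrightarrow> j < n \<Longrightarrow> t j \<le> t i"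
    and sv: "\<And>i. i < min m n \<Longrightarrow> singular_value i X = t i"
    by (rule gram_matrix_diagonalization[OF X]) (rule that)
  have c: "X * V \<in> carrier_mat m n" using X V by (auto simp: orthonormal_mat_def)
  have "(\<Sum>i<min m n. (singular_value i X)\<^sup>2) = (\<Sum>i<min m n. (t i)\<^sup>2)" using sv by simp
  also have "\<dots> \<le> (\<Sum>j<n. (t j)\<^sup>2)" by (intro sum_mono2) auto
  also have "\<dots> = (\<Sum>j<n. \<Sum>i<m. ((X * V) $$ (i, j))\<^sup>2)"
    using gram by (simp add: power2_eq_square)
  also have "\<dots> = (frobenius_norm (X * V))\<^sup>2" unfolding frobenius_norm_sq[OF c] by (rule sum.swap)
  also have "frobenius_norm (X * V) = frobenius_norm X"
    using frobenius_norm_orthonormal[of m "1\<^sub>m m" n "transpose_mat V" X] X V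
    by (simp add: orthonormal_mat_def)
  finally show ?thesis .
qed

lemma singular_value_nonneg:
  assumes X: "X \<in> carrier_mat m n" and i: "i < min m n"
  shows "0 \<le> singular_value i X"
proof -
  obtain V t where "orthonormal_mat n V"
    and "\<And>j l. j < n \<Longrightarrow> l < n \<Longrightarrow>
      (\<Sum>i<m. (X * V) $$ (i, j) * (X * V) $$ (i, l)) = (if j = l then (t j)\<^sup>2 else 0)"
    and t: "\<And>i. i < n \<Longrightarrow> 0 \<le> t i" "\<And>i j. i \<le> j \<Longrightarrow> j < n \<Longrightarrow> t j \<le> t i"
    and sv: "\<And>i. i < min m n \<Longrightarrow> singular_value i X = t i"
    by (rule gram_matrix_diagonalization[OF X]) (rule that)
  show ?thesis using i t sv by simp
qed

lemma singular_value_antimono: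
  assumes X: "X \<in> carrier_mat m n" and ij: "i \<le> j" "j < min m n"
  shows "singular_value j X \<le> singular_value i X"
proof -
  obtain V t where "orthonormal_mat n V"
    and "\<And>j l. j < n \<Longrightarrow> l < n \<Longrightarrow>
      (\<Sum>i<m. (X * V) $$ (i, j) * (X * V) $$ (i, l)) = (if j = l then (t j)\<^sup>2 else 0)"
    and t: "\<And>i. i < n \<Longrightarrow> 0 \<le> t i" "\<And>i j. i \<le> j \<Longrightarrow> j < n \<Longrightarrow> t j \<le> t i"
    and sv: "\<And>i. i < min m n \<Longrightarrow> singular_value i X = t i"
    by (rule gram_matrix_diagonalization[OF X]) (rule that)
  show ?thesis using ij t sv by simp
qed

text \<open>Writing \<open>X\<close> as \<open>(X * V) * transpose_mat V\<close> expands
  \<open>X $$ (i, i)\<close> into products of an entry of \<open>X * V\<close>, whose columns are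
  orthogonal, and an entry of \<open>V\<close>, whose rows and columns have length 1.\<close>

lemma von_neumann_diagonal:
  assumes X: "X \<in> carrier_mat m n"
    and s: "\<And>i. i < min m n \<Longrightarrow> 0 \<le> s i" "\<And>i j. i \<le> j \<Longrightarrow> j < min m n \<Longrightarrow> s j \<le> s i"
  shows "(\<Sum>i<min m n. s i * X $$ (i, i)) \<le> (\<Sum>i<min m n. s i * singular_value i X)"
proof -
  obtain V t where V: "orthonormal_mat n V"
    and gram: "\<And>j l. j < n \<Longrightarrow> l < n \<Longrightarrow>
      (\<Sum>i<m. (X * V) $$ (i, j) * (X * V) $$ (i, l)) = (if j = l then (t j)\<^sup>2 else 0)"
    and t: "\<And>i. i < n \<Longrightarrow> 0 \<le> t i" "\<And>i j. i \<le> j \<Longrightarrow> j < n \<Longrightarrow> t j \<le> t i"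
    and sv: "\<And>i. i < min m n \<Longrightarrow> singular_value i X = t i"
    by (rule gram_matrix_diagonalization[OF X]) (rule that)
  have Vc: "V \<in> carrier_mat n n" "transpose_mat V \<in> carrier_mat n n"
    and VV: "transpose_mat V * V = 1\<^sub>m n" "V * transpose_mat V = 1\<^sub>m n"
    using V by (auto simp: orthonormal_mat_def)
  have "(\<Sum>i<n. (V $$ (i, j))\<^sup>2) = 1" if "j < n" for j
    using arg_cong[OF VV(1), of "\<lambda>A. A $$ (j, j)"] that Vc
    by (simp add: scalar_prod_def atLeast0LessThan power2_eq_square)
  moreover have "(\<Sum>j<n. (V $$ (i, j))\<^sup>2) = 1" if "i < n" for i
    using arg_cong[OF VV(2), of "\<lambda>A. A $$ (i, i)"] that Vc
    by (simp add: scalar_prod_def atLeast0LessThan power2_eq_square)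
  ultimately have "(\<Sum>i<min m n. s i * (\<Sum>j<n. (X * V) $$ (i, j) * V $$ (i, j))) \<le> (\<Sum>i<min m n. s i * t i)"
    by (intro von_neumann_trace_sum[where m = m] gram s t) auto
  moreover have "X $$ (i, i) = (\<Sum>j<n. (X * V) $$ (i, j) * V $$ (i, j))" if "i < min m n" for i
  proof -
    have "X = (X * V) * transpose_mat V"
      using X Vc VV by (simp add: assoc_mult_mat[of _ m n _ n _ n])
    then have "X $$ (i, i) = ((X * V) * transpose_mat V) $$ (i, i)" by simp
    also have "\<dots> = (\<Sum>j<n. (X * V) $$ (i, j) * V $$ (i, j))"
      using that X Vc by (subst index_mult_mat) (auto simp: scalar_prod_def atLeast0LessThan)
    finally show ?thesis .
  qed
  ultimately show ?thesis using sv by simp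
qed

section \<open>Quadratic growth of the objective\<close>

lemma sum_diagonal:
  fixes f :: "nat \<Rightarrow> nat \<Rightarrow> real"
  assumes "\<And>i j. i < m \<Longrightarrow> j < n \<Longrightarrow> i \<noteq> j \<Longrightarrow> f i j = 0"
  shows "(\<Sum>i<m. \<Sum>j<n. f i j) = (\<Sum>i<min m n. f i i)"
proof -
  have "(\<Sum>i<m. \<Sum>j<n. f i j) = (\<Sum>i<m. if i < n then f i i else 0)"
  proof (rule sum.cong[OF refl])
    fix i assume i: "i \<in> {..<m}"
    have "(\<Sum>j<n. f i j) = (\<Sum>j<n. if j = i then f i i else 0)"
      using assms i by (intro sum.cong) auto
    then show "(\<Sum>j<n. f i j) = (if i < n then f i i else 0)" by simp
  qed
  also have "\<dots> = (\<Sum>i<min m n. f i i)"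
    by (simp add: sum.If_cases Int_def min_def lessThan_def) (auto intro!: sum.cong)
  finally show ?thesis .
qed

lemma singular_value_diagonal:
  assumes D: "D \<in> carrier_mat m n" "diagonal_mat D"
    and d: "\<And>i. i < min m n \<Longrightarrow> 0 \<le> D $$ (i, i)"
      "\<And>i j. i \<le> j \<Longrightarrow> j < min m n \<Longrightarrow> D $$ (j, j) \<le> D $$ (i, i)"
    and i: "i < min m n"
  shows "singular_value i D = D $$ (i, i)"
proof -
  \<comment> \<open>The Gram matrix has n diagonal entries, so the diagonal of \<open>D\<close> is
    padded with zeros when n > m. Nonnegativity of the entries keeps the padded sequence
    nonincreasing.\<close>
  define t where "t i = (if i < min m n then D $$ (i, i) else 0)" for i
  have "transpose_mat D * D = mat_diag n (\<lambda>j. (t j)\<^sup>2)"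
  proof (rule eq_matI)
    fix j l assume "j < dim_row (mat_diag n (\<lambda>j. (t j)\<^sup>2))" "l < dim_col (mat_diag n (\<lambda>j. (t j)\<^sup>2))"
    then have j: "j < n" and l: "l < n" by (auto simp: mat_diag_def)
    have "(transpose_mat D * D) $$ (j, l) = (\<Sum>i<m. D $$ (i, j) * D $$ (i, l))"
      using D j l by (simp add: scalar_prod_def atLeast0LessThan)
    also have "\<dots> = (\<Sum>i<m. if i = j then (if j = l then (t j)\<^sup>2 else 0) else 0)"
      using D j l by (intro sum.cong) (auto simp: diagonal_mat_def t_def power2_eq_square)
    also have "\<dots> = (if j = l then (t j)\<^sup>2 else 0)" by (auto simp: t_def)
    finally show "(transpose_mat D * D) $$ (j, l) = mat_diag n (\<lambda>j. (t j)\<^sup>2) $$ (j, l)"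
      using j l by (simp add: mat_diag_def)
  qed (use D in \<open>auto simp: mat_diag_def\<close>)
  then have "char_poly (transpose_mat D * D) = (\<Prod>j\<leftarrow>[0..<n]. [:- (t j)\<^sup>2, 1:])"
    by (simp add: char_poly_mat_diag)
  from singular_value_eqI[OF D(1) this _ _ i] d have "singular_value i D = t i"
    by (auto simp: t_def)
  then show ?thesis using i by (simp add: t_def)
qed

lemma objective_orthonormal:
  assumes U: "orthonormal_mat m U" and V: "orthonormal_mat n V"
    and D: "D \<in> carrier_mat m n" and Z: "Z \<in> carrier_mat m n"
  shows "objective \<phi> lam (U * D * transpose_mat V) (U * Z * transpose_mat V) = objective \<phi> lam D Z"
proof -
  have c: "U \<in> carrier_mat m m" "V \<in> carrier_mat n n" "transpose_mat V \<in> carrier_mat n n"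
    using U V by (auto simp: orthonormal_mat_def)
  have "U * D * transpose_mat V - U * Z * transpose_mat V = U * (D - Z) * transpose_mat V"
    using c D Z by (simp add: mult_minus_distrib_mat[of _ m m _ n] minus_mult_distrib_mat[of _ m n _ _ n])
  moreover have "frobenius_norm (U * (D - Z) * transpose_mat V) = frobenius_norm (D - Z)"
    by (rule frobenius_norm_orthonormal[OF U V]) (use D Z in auto)
  ultimately show ?thesis
    using c D Z
    by (simp add: objective_def singular_value_orthonormal[OF U V Z] del: assoc_mult_mat)
qed

text \<open>The quadratic surplus \<open>(1 - lam * a) / 2\<close> times the squared distance to
  \<open>P\<close> gives minimality and uniqueness at once. It is split off exactly from the data
  term; the remaining terms are bounded below through the singular values of \<open>Z\<close> alone,
  where the scalar subgradient inequalities apply.\<close>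

lemma objective_diagonal_growth:
  assumes pen: "nonconvex_penalty \<phi> a" and a: "0 \<le> a" and lam: "0 < lam" "a < 1 / lam"
    and D: "D \<in> carrier_mat m n" "diagonal_mat D"
    and d: "\<And>i. i < min m n \<Longrightarrow> 0 \<le> D $$ (i, i)"
      "\<And>i j. i \<le> j \<Longrightarrow> j < min m n \<Longrightarrow> D $$ (j, j) \<le> D $$ (i, i)"
    and Z: "Z \<in> carrier_mat m n"
  defines "P \<equiv> map_mat (prox \<phi> lam) D"
  shows "objective \<phi> lam D P + (1 - lam * a) / 2 * (frobenius_norm (Z - P))\<^sup>2 \<le> objective \<phi> lam D Z"
proof -
  let ?k = "min m n"
  define \<mu> where "\<mu> = 1 - lam * a"
  define h where "h x = lam * (a / 2 * x\<^sup>2 + \<phi> x)" for x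
  define x where "x i = prox \<phi> lam (D $$ (i, i))" for i
  define s where "s i = D $$ (i, i) - \<mu> * x i" for i
  note prox = prox_order[OF pen a lam]
  have P: "P \<in> carrier_mat m n" using D by (simp add: P_def)
  have P_ii: "P $$ (i, i) = x i" if "i < ?k" for i using that D by (simp add: P_def x_def)
  \<comment> \<open>The entrywise map keeps the matrix diagonal because \<open>prox\<close> sends 0
    to 0.\<close>
  have P_ij: "P $$ (i, j) = 0" "D $$ (i, j) = 0" if "i < m" "j < n" "i \<noteq> j" for i j
    using that D prox(1) by (auto simp: P_def diagonal_mat_def)
  \<comment> \<open>\<open>prox\<close> preserves nonnegativity and order, so the diagonal of
    \<open>P\<close> already lists its singular values in the right order.\<close>
  have sv_P: "singular_value i P = x i" if "i < ?k" for i
  proof -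
    have "singular_value i P = P $$ (i, i)"
    proof (rule singular_value_diagonal[OF P _ _ _ that])
      show "diagonal_mat P" using P P_ij by (auto simp: diagonal_mat_def)
    qed (use d prox in \<open>auto simp: P_ii x_def\<close>)
    then show ?thesis using P_ii[OF that] by simp
  qed
  define K where "K = (\<Sum>i<?k. 1 / 2 * (D $$ (i, i))\<^sup>2 - \<mu> / 2 * (x i)\<^sup>2)"
  \<comment> \<open>The square is expanded entrywise using that \<open>\<mu>\<close> and
    \<open>lam * a\<close> add up to 1. The rest \<open>f\<close> is affine in \<open>W\<close> and
    vanishes off the diagonal, and \<open>K\<close> is its constant part. The identity is used both
    for \<open>P\<close> and for \<open>Z\<close>.\<close>
  have split: "1 / 2 * (frobenius_norm (D - W))\<^sup>2 =
      \<mu> / 2 * (frobenius_norm (W - P))\<^sup>2 + K - (\<Sum>i<?k. s i * W $$ (i, i)) + lam * a / 2 * (frobenius_norm W)\<^sup>2"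
    if W: "W \<in> carrier_mat m n" for W
  proof -
    define f where "f i j = 1 / 2 * (D $$ (i, j))\<^sup>2 - \<mu> / 2 * (P $$ (i, j))\<^sup>2
      - (D $$ (i, j) - \<mu> * P $$ (i, j)) * W $$ (i, j)" for i j
    have DW: "D - W \<in> carrier_mat m n" and WP: "W - P \<in> carrier_mat m n" using D W P by auto
    have "1 / 2 * (frobenius_norm (D - W))\<^sup>2 = (\<Sum>i<m. \<Sum>j<n. 1 / 2 * (D $$ (i, j) - W $$ (i, j))\<^sup>2)"
      unfolding frobenius_norm_sq[OF DW] using D W by (simp add: sum_distrib_left)
    also have "\<dots> = (\<Sum>i<m. \<Sum>j<n. \<mu> / 2 * (W $$ (i, j) - P $$ (i, j))\<^sup>2 + f i j + lam * a / 2 * (W $$ (i, j))\<^sup>2)"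
      by (intro sum.cong refl) (simp add: f_def \<mu>_def power2_eq_square field_simps)
    also have "\<dots> = \<mu> / 2 * (frobenius_norm (W - P))\<^sup>2 + (\<Sum>i<m. \<Sum>j<n. f i j) + lam * a / 2 * (frobenius_norm W)\<^sup>2"
      unfolding frobenius_norm_sq[OF WP] frobenius_norm_sq[OF W] using P W
      by (simp add: sum.distrib sum_distrib_left)
    also have "(\<Sum>i<m. \<Sum>j<n. f i j) = (\<Sum>i<?k. f i i)"
      by (rule sum_diagonal) (simp add: f_def P_ij)
    also have "\<dots> = K - (\<Sum>i<?k. s i * W $$ (i, i))"
      by (simp add: K_def f_def s_def P_ii flip: sum_subtractf)
    finally show ?thesis by simp
  qed
  have sub: "h (x i) - s i * x i \<le> h y - s i * y" for i y
    using prox_subgradient(2)[OF pen a lam, of "D $$ (i, i)" y]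
    by (simp add: h_def x_def s_def \<mu>_def algebra_simps)
  have sum_h: "(\<Sum>i<?k. h (y i) - s i * y i) =
      lam * a / 2 * (\<Sum>i<?k. (y i)\<^sup>2) + lam * (\<Sum>i<?k. \<phi> (y i)) - (\<Sum>i<?k. s i * y i)" for y
    by (simp add: h_def sum_subtractf sum.distrib distrib_left sum_distrib_left mult.assoc)
  \<comment> \<open>The trace inequality needs \<open>s\<close> nonnegative and nonincreasing, which
    is the residual part of \<open>prox_order\<close>.\<close>
  have "(\<Sum>i<?k. s i * Z $$ (i, i)) \<le> (\<Sum>i<?k. s i * singular_value i Z)"
    by (rule von_neumann_diagonal[OF Z]) (use d prox in \<open>auto simp: s_def x_def \<mu>_def\<close>)
  moreover have "lam * a / 2 * (\<Sum>i<?k. (singular_value i Z)\<^sup>2) \<le> lam * a / 2 * (frobenius_norm Z)\<^sup>2"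
    by (rule mult_left_mono[OF sum_singular_values_sq_le[OF Z]]) (use a lam in auto)
  moreover have "(\<Sum>i<?k. h (x i) - s i * x i) \<le> (\<Sum>i<?k. h (singular_value i Z) - s i * singular_value i Z)"
    by (intro sum_mono sub)
  moreover have "objective \<phi> lam D P = K + (\<Sum>i<?k. h (x i) - s i * x i)"
  proof -
    have "(frobenius_norm P)\<^sup>2 = (\<Sum>i<?k. (x i)\<^sup>2)"
      unfolding frobenius_norm_sq[OF P] by (subst sum_diagonal) (auto simp: P_ij P_ii)
    moreover have "frobenius_norm (P - P) = 0" using P by (simp add: frobenius_norm_def)
    ultimately show ?thesis
      unfolding objective_def split[OF P] sum_h using P by (simp add: P_ii sv_P)
  qed
  moreover have "objective \<phi> lam D Z = \<mu> / 2 * (frobenius_norm (Z - P))\<^sup>2 + K - (\<Sum>i<?k. s i * Z $$ (i, i))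
      + lam * a / 2 * (frobenius_norm Z)\<^sup>2 + lam * (\<Sum>i<?k. \<phi> (singular_value i Z))"
    unfolding objective_def split[OF Z] using Z by simp
  ultimately show ?thesis
    using sum_h[of "\<lambda>i. singular_value i Z"] unfolding \<mu>_def[symmetric] by linarith
qed

lemma frobenius_norm_diff_eq_0:
  assumes "A \<in> carrier_mat m n" "B \<in> carrier_mat m n" "frobenius_norm (A - B) = 0"
  shows "A = B"
proof (rule eq_matI)
  have "(\<Sum>i<m. \<Sum>j<n. ((A - B) $$ (i, j))\<^sup>2) = 0"
    using frobenius_norm_sq[OF minus_carrier_mat[OF assms(2)], of A] assms by simp
  then have "\<forall>i<m. \<forall>j<n. (A - B) $$ (i, j) = 0"
    by (simp add: sum_nonneg_eq_0_iff sum_nonneg)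
  then show "A $$ (i, j) = B $$ (i, j)" if "i < dim_row B" "j < dim_col B" for i j
    using that assms by auto
qed (use assms in auto)

theorem theorem2:
  fixes m n :: nat and lam a :: real and \<phi> :: "real \<Rightarrow> real" and Y U S V :: "real mat"
  assumes "m \<ge> 1" and "n \<ge> 1"
    and "lam > 0"
    and "nonconvex_penalty \<phi> a"
    and "Y \<in> carrier_mat m n"
    and "is_svd m n Y U S V"
    and "0 \<le> a" and "a < 1 / lam"
  shows "\<forall>X. is_arg_min (objective \<phi> lam Y) (\<lambda>X. X \<in> carrier_mat m n) X \<longleftrightarrow>
             X = U * map_mat (prox \<phi> lam) S * transpose_mat V"
proof -
  define P where "P = map_mat (prox \<phi> lam) S"
  define Xbar where "Xbar = U * P * transpose_mat V"
  have U: "orthonormal_mat m U" and V: "orthonormal_mat n V"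
    and S: "S \<in> carrier_mat m n" "diagonal_mat S" and Y: "Y = U * S * transpose_mat V"
    and sv: "\<And>i. i < min m n \<Longrightarrow> S $$ (i, i) = singular_value i Y"
    using assms(6) by (auto simp: is_svd_def)
  have c: "U \<in> carrier_mat m m" "transpose_mat U \<in> carrier_mat m m"
    "V \<in> carrier_mat n n" "transpose_mat V \<in> carrier_mat n n" and P: "P \<in> carrier_mat m n"
    using U V S by (auto simp: orthonormal_mat_def P_def)
  have Xbar: "Xbar \<in> carrier_mat m n" unfolding Xbar_def using c P by simp
  have \<mu>: "0 < 1 - lam * a" by (rule prox_subgradient(1)[OF assms(4,7,3,8)])
  \<comment> \<open>In the coordinates given by \<open>U\<close> and \<open>V\<close> the data
    matrix is \<open>S\<close> and the candidate is \<open>P\<close>, so the diagonal estimate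
    applies to the rotated \<open>X\<close>.\<close>
  have growth: "objective \<phi> lam Y Xbar + (1 - lam * a) / 2 * (frobenius_norm (transpose_mat U * X * V - P))\<^sup>2
      \<le> objective \<phi> lam Y X" if X: "X \<in> carrier_mat m n" for X
  proof -
    define Z where "Z = transpose_mat U * X * V"
    have Z: "Z \<in> carrier_mat m n" unfolding Z_def using X c by simp
    have "X = U * Z * transpose_mat V"
      unfolding Z_def by (rule orthonormal_mat_cancel[OF U V X, symmetric])
    then have "objective \<phi> lam Y X = objective \<phi> lam S Z"
      unfolding Y by (simp only: objective_orthonormal[OF U V S(1) Z])
    moreover have "objective \<phi> lam Y Xbar = objective \<phi> lam S P"
      unfolding Y Xbar_def by (rule objective_orthonormal[OF U V S(1) P])
    \<comment> \<open>The sign and order conditions on the diagonal of \<open>S\<close> hold because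
      its entries are the singular values of \<open>Y\<close>.\<close>
    moreover have "objective \<phi> lam S P + (1 - lam * a) / 2 * (frobenius_norm (Z - P))\<^sup>2 \<le> objective \<phi> lam S Z"
      unfolding P_def
      by (rule objective_diagonal_growth[OF assms(4,7,3,8) S _ _ Z])
        (auto simp: sv singular_value_nonneg[OF assms(5)] singular_value_antimono[OF assms(5)])
    ultimately show ?thesis by (simp add: Z_def)
  qed
  have min: "objective \<phi> lam Y Xbar \<le> objective \<phi> lam Y X" if "X \<in> carrier_mat m n" for X
  proof -
    have "0 \<le> (1 - lam * a) / 2 * (frobenius_norm (transpose_mat U * X * V - P))\<^sup>2" using \<mu> by simp
    then show ?thesis using growth[OF that] by linarith
  qed
  \<comment> \<open>A competitor that is no worse leaves no room for the quadratic surplus, so its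
    rotated form equals \<open>P\<close>; rotating back gives \<open>Xbar\<close>.\<close>
  have uniq: "X = Xbar" if X: "X \<in> carrier_mat m n" and le: "objective \<phi> lam Y X \<le> objective \<phi> lam Y Xbar" for X
  proof -
    have "(1 - lam * a) / 2 * (frobenius_norm (transpose_mat U * X * V - P))\<^sup>2 \<le> 0"
      using growth[OF X] le by linarith
    then have "frobenius_norm (transpose_mat U * X * V - P) = 0"
      using \<mu> by (simp add: mult_le_0_iff)
    then have "transpose_mat U * X * V = P"
      by (intro frobenius_norm_diff_eq_0[of _ m n]) (use X c P in auto)
    then show ?thesis
      unfolding Xbar_def using orthonormal_mat_cancel[OF U V X] by simp
  qed
  show ?thesis
    unfolding P_def[symmetric] Xbar_def[symmetric] is_arg_min_def
    using Xbar min uniq by (metis linorder_not_less)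
qed

end
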